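(* Let $[\eta]_f, [\delta]_g \in \mathscr{H}_R(G, \mathscr{P}, V)$ with $\eta, \delta \in W$ and, in the case $l(\eta) > 1$, write $\eta = \eta' v$ with $v \in S = \{w, w'\}$. Then \begin{equation*} [\eta]_f\ast [\delta]_g = \begin{cases} [\eta\delta]_{fg} & \text{ if }l(\eta\delta) = l(\eta)+l(\delta);\\ \tau\,[\eta\delta]_{fg} + [\eta'\delta]_{fg}^1 & \text{ if }l(\eta) = l(\delta) =1 \text{ and } l(\eta\delta) = 0. \end{cases} \end{equation*} (No statement is made for the case $l(\eta\delta) \neq l(\eta)+l(\delta)$ and $\max(l(\eta), l(\delta)) > 1$.)
   Context: Let $F$ be a non-archimedean local field with ring of integers $\mathcal{O}$, uniformizer $\varpi$, residue field $\mathbb{F}_q$ of characteristic $p$; $R$ an algebraically closed field of characteristic $\ell \neq p$. Let $n = 2k$, $G = \operatorname{GL}_n(F)$, $\mathcal{M} = \operatorname{GL}_k(q) \times \operatorname{GL}_k(q)$, and $\mathscr{P} \subset G$ the standard parahoric subgroup with $\mathscr{P}/\mathscr{P}(1) \cong \mathcal{M}$. Let $(V, \sigma)$ be a finite-dimensional cuspidal (not necessarily irreducible) $R$-representation of $\mathcal{M}$, inflated to $\mathscr{P}$. $\mathscr{H}_R(G, \mathscr{P}, V) = \operatorname{End}_G(\operatorname{ind}_{\mathscr{P}}^G V)$ is the convolution algebra of functions $\varphi: G \to \operatorname{End}_R(V)$ with finite support in $\mathscr{P}\backslash G/\mathscr{P}$ and $\varphi(p_1 g p_2) = \sigma(p_1)\varphi(g)\sigma(p_2)$.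 Let $w$ be the block permutation matrix $\left(\begin{smallmatrix} 0 & 1_k \\ 1_k & 0\end{smallmatrix}\right)$, $t = \left(\begin{smallmatrix} 0 & 1_k \\ \varpi 1_k & 0\end{smallmatrix}\right)$, $w' = t w t^{-1}$, and let $W$ be the group generated by block-scalar diagonal matrices $\operatorname{diag}(\varpi^a 1_k, \varpi^b 1_k)$ and $w$; it is isomorphic to the affine Weyl group of $\operatorname{GL}_2(F)$, with length function $l$ satisfying $l(w) = l(w') = 1$, $l(t) = 0$. The support of $\mathscr{H}_R(G,\mathscr{P},V)$ lies in $\mathscr{P}W\mathscr{P}$; for $\eta \in W$, functions supported on $\mathscr{P}\eta\mathscr{P}$ are determined by their value at $\eta$, which lies in $I_1 = \operatorname{End}_{\mathcal{M}}(V)$ if $\eta$ is diagonal and in $I_w = \operatorname{Hom}_{\mathcal{M}}(V^w, V)$ otherwise; $[\eta]_f$ denotes the function supported on $\mathscr{P}\eta\mathscr{P}$ with value $f$ at $\eta$. Let $T^{\ast} = \sum_{g \in \operatorname{GL}_k(q)} \left(\begin{smallmatrix} g & \\ & -g^{-1}\end{smallmatrix}\right) \in R[\mathcal{M}]$ (acting on $V$), and $[\eta]^j_f := [\eta]_{(T^{\ast})^j f}$ (where parity of $j$ makes this meaningful). Let $\tau = q^{k^2} \bmod \ell \in \{1, \dots, \ell-1\}$.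
   Formalization: The decomposition η = η'v is taken when l(η) ≥ 1 (not only l(η) > 1, which leaves η' undefined where the formula uses it) and is required to be reduced, l(η) = l(η') + 1; with the other choice of v in S the second formula is false. *)

theory Defs
  imports "HOL-Analysis.Analysis" "HOL-Computational_Algebra.Computational_Algebra"
begin

section \<open>Non-archimedean local fields\<close>

text \<open>The normalised valuation \<open>val\<close> is only meaningful on nonzero elements; \<open>val_ge val N x\<close>
  says \<open>v(x) \<ge> N\<close> with the convention \<open>v(0) = \<infinity>\<close>.\<close>

definition val_ge :: "('f::field \<Rightarrow> int) \<Rightarrow> int \<Rightarrow> 'f \<Rightarrow> bool" where
  "val_ge val N x \<longleftrightarrow> x = 0 \<or> N \<le> val x"

definition integers :: "('f::field \<Rightarrow> int) \<Rightarrow> 'f set" where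
  "integers val = {x. val_ge val 0 x}"

definition max_ideal :: "('f::field \<Rightarrow> int) \<Rightarrow> 'f set" where
  "max_ideal val = {x. val_ge val 1 x}"

text \<open>A field complete with respect to a discrete valuation and with finite residue field. The
  residue field is a finite field type \<open>'q\<close>, identified with the ring of integers modulo its
  maximal ideal through the reduction map \<open>res\<close>; values of \<open>res\<close> outside the ring of integers
  are irrelevant.\<close>

locale nonarch_local_field =
  fixes val :: "'f::field \<Rightarrow> int"
    and res :: "'f \<Rightarrow> 'q::{field,finite}"
  assumes val_mult: "x \<noteq> 0 \<Longrightarrow> y \<noteq> 0 \<Longrightarrow> val (x * y) = val x + val y"
    and val_add: "x \<noteq> 0 \<Longrightarrow> y \<noteq> 0 \<Longrightarrow> x + y \<noteq> 0 \<Longrightarrow> min (val x) (val y) \<le> val (x + y)"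
    and val_normalised: "\<exists>x. x \<noteq> 0 \<and> val x = 1"
    and complete:
      "(\<And>N. \<exists>M. \<forall>m\<ge>M. \<forall>n\<ge>M. val_ge val N (X m - X n)) \<Longrightarrow>
        \<exists>L. \<forall>N. \<exists>M. \<forall>m\<ge>M. val_ge val N (X (m::nat) - L)"
    and res_one: "res 1 = 1"
    and res_add: "x \<in> integers val \<Longrightarrow> y \<in> integers val \<Longrightarrow> res (x + y) = res x + res y"
    and res_mult: "x \<in> integers val \<Longrightarrow> y \<in> integers val \<Longrightarrow> res (x * y) = res x * res y"
    and res_surj: "res ` integers val = UNIV"
    and res_kernel: "x \<in> integers val \<Longrightarrow> res x = 0 \<longleftrightarrow> x \<in> max_ideal val"

definition uniformizer :: "('f::field \<Rightarrow> int) \<Rightarrow> 'f \<Rightarrow> bool" where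
  "uniformizer val \<pi> \<longleftrightarrow> \<pi> \<noteq> 0 \<and> val \<pi> = 1"

section \<open>Block matrices and the parahoric subgroup\<close>

text \<open>With \<open>k = CARD('k)\<close>, a matrix of size \<open>n = 2k\<close> is indexed by \<open>'k + 'k\<close>; the summands
  index the two block rows and columns.\<close>

type_synonym ('a, 'k) bmat = "'a ^ ('k + 'k) ^ ('k + 'k)"

type_synonym ('q, 'k) levi = "('q ^ 'k ^ 'k) \<times> ('q ^ 'k ^ 'k)"

definition block :: "'a^'k^'k \<Rightarrow> 'a^'k^'k \<Rightarrow> 'a^'k^'k \<Rightarrow> 'a^'k^'k \<Rightarrow> ('a, 'k::finite) bmat" where
  "block A B C D = (\<chi> i j. case (i, j) of
      (Inl a, Inl b) \<Rightarrow> A $ a $ b | (Inl a, Inr b) \<Rightarrow> B $ a $ b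
    | (Inr a, Inl b) \<Rightarrow> C $ a $ b | (Inr a, Inr b) \<Rightarrow> D $ a $ b)"

definition GL :: "('a::field ^ 'n ^ 'n::finite) set" where
  "GL = {g. invertible g}"

definition GL_integers :: "('f::field \<Rightarrow> int) \<Rightarrow> ('f ^ 'n ^ 'n::finite) set" where
  "GL_integers val = {g \<in> GL. (\<forall>i j. g $ i $ j \<in> integers val) \<and>
     (\<forall>i j. matrix_inv g $ i $ j \<in> integers val)}"

definition parahoric :: "('f::field \<Rightarrow> int) \<Rightarrow> ('f, 'k::finite) bmat set" where
  "parahoric val = {g \<in> GL_integers val. \<forall>i j. g $ Inr i $ Inl j \<in> max_ideal val}"

definition Levi :: "('q::field, 'k::finite) levi set" where
  "Levi = GL \<times> GL"

text \<open>The quotient map from the parahoric subgroup onto its reductive quotient; its kernel is the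
  pro-unipotent radical.\<close>

definition reduction :: "('f::field \<Rightarrow> 'q::field) \<Rightarrow> ('f, 'k::finite) bmat \<Rightarrow> ('q, 'k) levi" where
  "reduction res g = ((\<chi> i j. res (g $ Inl i $ Inl j)), (\<chi> i j. res (g $ Inr i $ Inr j)))"

section \<open>Cuspidal representations of the finite Levi group\<close>

definition representation ::
    "('r::field \<Rightarrow> 'v::ab_group_add \<Rightarrow> 'v) \<Rightarrow> (('q::field, 'k::finite) levi \<Rightarrow> 'v \<Rightarrow> 'v) \<Rightarrow> bool" where
  "representation smul \<sigma> \<longleftrightarrow>
     (\<forall>m\<in>Levi. Vector_Spaces.linear smul smul (\<sigma> m)) \<and>
     \<sigma> (mat 1, mat 1) = id \<and>
     (\<forall>(a, b)\<in>Levi. \<forall>(c, d)\<in>Levi. \<sigma> (a ** c, b ** d) = \<sigma> (a, b) \<circ> \<sigma> (c, d))"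

text \<open>A labelling \<open>c\<close> of the coordinates describes an ordered partition of the standard basis, hence
  the parabolic subgroup of all \<open>g\<close> with \<open>g $ i $ j = 0\<close> whenever \<open>c j < c i\<close>. Every parabolic subgroup
  of the general linear group is conjugate, by some \<open>x\<close>, to one of these, and it is proper iff \<open>c\<close>
  is not constant. The following set is the unipotent radical of that conjugate.\<close>

definition unipotent_radical ::
    "('k \<Rightarrow> nat) \<Rightarrow> 'q ^ 'k ^ 'k \<Rightarrow> ('q::field ^ 'k ^ 'k::finite) set" where
  "unipotent_radical c x = {x ** u ** matrix_inv x | u.
     u \<in> GL \<and> (\<forall>i j. c j \<le> c i \<longrightarrow> u $ i $ j = mat 1 $ i $ j)}"

text \<open>Cuspidality: the parabolic restriction (invariants under the unipotent radical) vanishes for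
  every proper parabolic subgroup of the product group.\<close>

definition cuspidal :: "(('q::field, 'k::finite) levi \<Rightarrow> 'v::ab_group_add \<Rightarrow> 'v) \<Rightarrow> bool" where
  "cuspidal \<sigma> \<longleftrightarrow>
     (\<forall>c d. \<forall>x\<in>GL. \<forall>y\<in>GL. \<not> (c constant_on UNIV \<and> d constant_on UNIV) \<longrightarrow>
        {v. \<forall>m \<in> unipotent_radical c x \<times> unipotent_radical d y. \<sigma> m v = v} = {0})"

definition intertwiners ::
    "('r::field \<Rightarrow> 'v::ab_group_add \<Rightarrow> 'v) \<Rightarrow> (('q::field, 'k::finite) levi \<Rightarrow> 'v \<Rightarrow> 'v)
      \<Rightarrow> (('q, 'k) levi \<Rightarrow> 'v \<Rightarrow> 'v) \<Rightarrow> ('v \<Rightarrow> 'v) set" where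
  "intertwiners smul \<sigma>1 \<sigma>2 = {f. Vector_Spaces.linear smul smul f \<and>
     (\<forall>m\<in>Levi. f \<circ> \<sigma>1 m = \<sigma>2 m \<circ> f)}"

text \<open>Conjugation by the block permutation matrix exchanges the two factors of the Levi group.\<close>

definition w_twist ::
    "(('q, 'k::finite) levi \<Rightarrow> 'v \<Rightarrow> 'v) \<Rightarrow> ('q, 'k) levi \<Rightarrow> 'v \<Rightarrow> 'v" where
  "w_twist \<sigma> m = \<sigma> (prod.swap m)"

definition T_star ::
    "(('q::field, 'k::finite) levi \<Rightarrow> 'v::ab_group_add \<Rightarrow> 'v) \<Rightarrow> 'v \<Rightarrow> 'v" where
  "T_star \<sigma> v = (\<Sum>g\<in>GL. \<sigma> (g, - matrix_inv g) v)"

section \<open>The extended affine Weyl group\<close>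

definition block_diag :: "'f::field \<Rightarrow> int \<Rightarrow> int \<Rightarrow> ('f, 'k::finite) bmat" where
  "block_diag \<pi> a b = block (mat (\<pi> powi a)) 0 0 (mat (\<pi> powi b))"

definition w_mat :: "('f::field, 'k::finite) bmat" where
  "w_mat = block 0 (mat 1) (mat 1) 0"

definition t_mat :: "'f::field \<Rightarrow> ('f, 'k::finite) bmat" where
  "t_mat \<pi> = block 0 (mat 1) (mat \<pi>) 0"

definition w'_mat :: "'f::field \<Rightarrow> ('f, 'k::finite) bmat" where
  "w'_mat \<pi> = t_mat \<pi> ** w_mat ** matrix_inv (t_mat \<pi>)"

definition simple_refls :: "'f::field \<Rightarrow> ('f, 'k::finite) bmat set" where
  "simple_refls \<pi> = {w_mat, w'_mat \<pi>}"

inductive_set Weyl :: "'f::field \<Rightarrow> ('f, 'k::finite) bmat set" for \<pi> :: 'f where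
  diag: "block_diag \<pi> a b \<in> Weyl \<pi>"
| w: "w_mat \<in> Weyl \<pi>"
| mult: "x \<in> Weyl \<pi> \<Longrightarrow> y \<in> Weyl \<pi> \<Longrightarrow> x ** y \<in> Weyl \<pi>"
| inv: "x \<in> Weyl \<pi> \<Longrightarrow> matrix_inv x \<in> Weyl \<pi>"

definition mat_powi :: "'a::field ^ 'n ^ 'n::finite \<Rightarrow> int \<Rightarrow> 'a ^ 'n ^ 'n" where
  "mat_powi A i = (if 0 \<le> i then ((**) A ^^ nat i) (mat 1)
                   else ((**) (matrix_inv A) ^^ nat (- i)) (mat 1))"

text \<open>The extended affine Weyl group is the semidirect product of the Coxeter group generated by the
  simple reflections and the infinite cyclic group generated by \<open>t\<close>. The length is the Coxeter length
  of the first component, so that powers of \<open>t\<close> have length zero.\<close>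

definition len :: "'f::field \<Rightarrow> ('f, 'k::finite) bmat \<Rightarrow> nat" where
  "len \<pi> \<eta> = (LEAST r. \<exists>ss i. length ss = r \<and> set ss \<subseteq> simple_refls \<pi> \<and>
     \<eta> = foldr (**) ss (mat_powi (t_mat \<pi>) i))"

section \<open>The Hecke algebra\<close>

definition double_coset ::
    "('f::field \<Rightarrow> int) \<Rightarrow> ('f, 'k::finite) bmat \<Rightarrow> ('f, 'k) bmat set" where
  "double_coset val g = {p1 ** g ** p2 | p1 p2. p1 \<in> parahoric val \<and> p2 \<in> parahoric val}"

definition left_cosets :: "('f::field \<Rightarrow> int) \<Rightarrow> ('f, 'k::finite) bmat set set" where
  "left_cosets val = {(**) h ` parahoric val | h. h \<in> GL}"

text \<open>Functions on the general linear group are represented by functions on all matrices that vanish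
  on the singular ones.\<close>

definition hecke_algebra ::
    "('r::field \<Rightarrow> 'v::ab_group_add \<Rightarrow> 'v) \<Rightarrow> ('f::field \<Rightarrow> int) \<Rightarrow> ('f \<Rightarrow> 'q::field)
      \<Rightarrow> (('q, 'k::finite) levi \<Rightarrow> 'v \<Rightarrow> 'v) \<Rightarrow> (('f, 'k) bmat \<Rightarrow> 'v \<Rightarrow> 'v) set" where
  "hecke_algebra smul val res \<sigma> = {\<phi>.
     (\<forall>g. g \<notin> GL \<longrightarrow> \<phi> g = (\<lambda>_. 0)) \<and>
     (\<forall>g\<in>GL. Vector_Spaces.linear smul smul (\<phi> g)) \<and>
     (\<forall>g\<in>GL. \<forall>p1\<in>parahoric val. \<forall>p2\<in>parahoric val.
        \<phi> (p1 ** g ** p2) = \<sigma> (reduction res p1) \<circ> \<phi> g \<circ> \<sigma> (reduction res p2)) \<and>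
     finite {double_coset val g | g. \<phi> g \<noteq> (\<lambda>_. 0)}}"

text \<open>\<open>(\<phi> * \<psi>)(g)\<close> is the sum of \<open>\<phi>(h) \<psi>(h\<^sup>-\<^sup>1 g)\<close> over the left cosets \<open>h\<P>\<close> of the parahoric
  subgroup \<open>\<P>\<close>. For \<open>\<phi>\<close> and \<open>\<psi>\<close> in the Hecke algebra the summand only depends on the coset and only the
  finitely many cosets in the support of \<open>\<phi>\<close> contribute.\<close>

definition convolution ::
    "('f::field \<Rightarrow> int) \<Rightarrow> (('f, 'k::finite) bmat \<Rightarrow> 'v::ab_group_add \<Rightarrow> 'v)
      \<Rightarrow> (('f, 'k) bmat \<Rightarrow> 'v \<Rightarrow> 'v) \<Rightarrow> ('f, 'k) bmat \<Rightarrow> 'v \<Rightarrow> 'v" where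
  "convolution val \<phi> \<psi> g v =
     (\<Sum>C\<in>{C \<in> left_cosets val. \<exists>h\<in>C. \<phi> h \<noteq> (\<lambda>_. 0)}.
        let h = (SOME h. h \<in> C) in \<phi> h (\<psi> (matrix_inv h ** g) v))"

definition is_diagonal :: "('f::field, 'k::finite) bmat \<Rightarrow> bool" where
  "is_diagonal \<eta> \<longleftrightarrow> (\<forall>i j. i \<noteq> j \<longrightarrow> \<eta> $ i $ j = 0)"

definition coeff_space ::
    "('r::field \<Rightarrow> 'v::ab_group_add \<Rightarrow> 'v) \<Rightarrow> (('q::field, 'k::finite) levi \<Rightarrow> 'v \<Rightarrow> 'v)
      \<Rightarrow> ('f::field, 'k) bmat \<Rightarrow> ('v \<Rightarrow> 'v) set" where
  "coeff_space smul \<sigma> \<eta> =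
     (if is_diagonal \<eta> then intertwiners smul \<sigma> \<sigma> else intertwiners smul (w_twist \<sigma>) \<sigma>)"

definition hecke_elt ::
    "('r::field \<Rightarrow> 'v::ab_group_add \<Rightarrow> 'v) \<Rightarrow> ('f::field \<Rightarrow> int) \<Rightarrow> ('f \<Rightarrow> 'q::field)
      \<Rightarrow> (('q, 'k::finite) levi \<Rightarrow> 'v \<Rightarrow> 'v) \<Rightarrow> ('f, 'k) bmat \<Rightarrow> ('v \<Rightarrow> 'v)
      \<Rightarrow> ('f, 'k) bmat \<Rightarrow> 'v \<Rightarrow> 'v" where
  "hecke_elt smul val res \<sigma> \<eta> f = (THE \<phi>. \<phi> \<in> hecke_algebra smul val res \<sigma> \<and>
     (\<forall>g. g \<notin> double_coset val \<eta> \<longrightarrow> \<phi> g = (\<lambda>_. 0)) \<and> \<phi> \<eta> = f)"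

definition hecke_elt_T ::
    "('r::field \<Rightarrow> 'v::ab_group_add \<Rightarrow> 'v) \<Rightarrow> ('f::field \<Rightarrow> int) \<Rightarrow> ('f \<Rightarrow> 'q::field)
      \<Rightarrow> (('q, 'k::finite) levi \<Rightarrow> 'v \<Rightarrow> 'v) \<Rightarrow> nat \<Rightarrow> ('f, 'k) bmat \<Rightarrow> ('v \<Rightarrow> 'v)
      \<Rightarrow> ('f, 'k) bmat \<Rightarrow> 'v \<Rightarrow> 'v" where
  "hecke_elt_T smul val res \<sigma> j \<eta> f = hecke_elt smul val res \<sigma> \<eta> ((T_star \<sigma> ^^ j) \<circ> f)"

end

theory Submission
  imports Defs
begin

text \<open>
  Write \<open>P\<close> for the parahoric subgroup. Its conjugates under the extended affine Weyl group are the
  groups \<open>P\<^sub>n\<close> of invertible matrices which, together with their inverses, have integral diagonal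
  blocks, upper right block of valuation at least \<open>n\<close> and lower left block of valuation at least
  \<open>1 - n\<close>. Conjugation by \<open>\<eta>\<close> maps \<open>P\<^sub>n\<close> to \<open>P\<^sub>m\<^sub>+\<^sub>n\<close> if \<open>\<eta>\<close> is diagonal and to \<open>P\<^sub>m\<^sub>-\<^sub>n\<close> otherwise, for
  some \<open>m\<close> with \<open>\<bar>m\<bar> = l(\<eta>)\<close>.

  When lengths add up, the indices of \<open>\<eta>\<^sup>-\<^sup>1\<close> and \<open>\<delta>\<close> have opposite signs, so the Iwahori factorisation
  puts \<open>P\<close> inside \<open>(\<eta>\<^sup>-\<^sup>1 P \<eta>) (\<delta> P \<delta>\<^sup>-\<^sup>1)\<close>. Hence \<open>P \<eta> P \<delta> P = P \<eta> \<delta> P\<close>, and since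
  \<open>P \<inter> (\<eta> \<delta>) P (\<eta> \<delta>)\<^sup>-\<^sup>1\<close> is contained in \<open>\<eta> P \<eta>\<^sup>-\<^sup>1\<close> only the coset \<open>\<eta> P\<close> contributes to the value
  at \<open>\<eta> \<delta>\<close>.

  In the quadratic case one has \<open>\<eta> = y w s\<^sup>-\<^sup>1\<close>, \<open>\<delta> = s w z\<close> and \<open>\<eta>' \<delta> = y w z\<close> with \<open>y, s, z\<close> of length
  zero. The cosets in \<open>P \<eta> P\<close> are indexed by the \<open>k \<times> k\<close> matrices over the residue field, and the
  product is supported on the double cosets of \<open>y l(C) z\<close> with \<open>l(C)\<close> lower unipotent and \<open>C\<close> integral.
  Modulo the maximal ideal, \<open>C = 0\<close> gives \<open>\<eta> \<delta>\<close>, invertible \<open>C\<close> gives \<open>\<eta>' \<delta>\<close>, and for the remaining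
  \<open>C\<close> the values are fixed by the unipotent radical of a proper parabolic subgroup, so they vanish by
  cuspidality.
\<close>

section \<open>Matrices in block form\<close>

lemma matrix_mult_zero_left [simp]: "(0 :: 'a::semiring_1^'n^'m) ** (A :: 'a^'p^'n) = 0"
  by (simp add: matrix_matrix_mult_def vec_eq_iff)

lemma matrix_mult_zero_right [simp]: "(A :: 'a::semiring_1^'n^'m) ** (0 :: 'a^'p^'n) = 0"
  by (simp add: matrix_matrix_mult_def vec_eq_iff)

lemma matrix_add_rdistrib: "(A + B) ** C = A ** C + B ** (C :: 'a::semiring_1^'p^'n)"
  by (simp add: matrix_matrix_mult_def vec_eq_iff distrib_right sum.distrib)

lemma matrix_mult_minus_left: "(- A) ** (C :: 'a::ring_1^'p^'n) = - (A ** C)"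
  by (simp add: matrix_matrix_mult_def vec_eq_iff sum_negf)

lemma matrix_mult_minus_right: "A ** (- C :: 'a::ring_1^'p^'n) = - (A ** C)"
  by (simp add: matrix_matrix_mult_def vec_eq_iff sum_negf)

lemma matrix_diff_rdistrib: "(A - B) ** (C :: 'a::ring_1^'p^'n) = A ** C - B ** C"
  by (simp add: matrix_matrix_mult_def vec_eq_iff left_diff_distrib sum_subtractf)

lemma matrix_diff_ldistrib: "A ** (B - C :: 'a::ring_1^'p^'n) = A ** B - A ** C"
  by (simp add: matrix_matrix_mult_def vec_eq_iff right_diff_distrib sum_subtractf)

lemmas matrix_ring_simps = matrix_add_ldistrib matrix_add_rdistrib matrix_mult_minus_left
  matrix_mult_minus_right matrix_diff_ldistrib matrix_diff_rdistrib matrix_mul_assoc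

lemma mat_mult_nth: "(mat c ** A) $ i $ j = c * (A $ i $ j :: 'a::semiring_1)"
  by (simp add: matrix_matrix_mult_def mat_def if_distrib[of "\<lambda>x. x * _"] cong: if_cong)

lemma mult_mat_nth: "(A ** mat c) $ i $ j = (A $ i $ j :: 'a::semiring_1) * c"
  by (simp add: matrix_matrix_mult_def mat_def if_distrib[of "\<lambda>x. _ * x"] cong: if_cong)

lemma mat_mult_mat: "(mat a :: 'a::semiring_1^'n^'n) ** mat b = mat (a * b)"
  by (simp add: vec_eq_iff mat_mult_nth) (simp add: mat_def)

lemma mat_eq_iff: "(mat a :: 'a::zero^'n^'n) = mat b \<longleftrightarrow> a = b"
  by (auto simp: vec_eq_iff mat_def)

lemma mat_eq_0_iff [simp]: "(mat a :: 'a::zero^'n^'n) = 0 \<longleftrightarrow> a = 0"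
  by (auto simp: vec_eq_iff mat_def)

lemma column_matrix_mult: "column j (A ** B) = A *v column j (B :: 'a::semiring_1^'p^'n)"
  by (simp add: column_def matrix_matrix_mult_def matrix_vector_mult_def vec_eq_iff)

lemma matrix_eq_columnsI: "(\<And>j. column j A = column j B) \<Longrightarrow> A = B"
  by (simp add: column_def vec_eq_iff)

lemma GL_right_inverse:
  fixes A B :: "'a::field^'n^'n"
  assumes "A ** B = mat 1"
  shows "A \<in> GL" and "matrix_inv A = B"
proof -
  have BA: "B ** A = mat 1"
    using assms by (simp add: matrix_left_right_inverse)
  with assms show "A \<in> GL"
    by (auto simp: GL_def invertible_def)
  have "A ** matrix_inv A = mat 1"
    unfolding matrix_inv_def by (rule someI2[of _ B]) (simp_all add: assms BA)
  then have "B ** (A ** matrix_inv A) = B"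
    by simp
  then show "matrix_inv A = B"
    by (simp add: matrix_mul_assoc BA)
qed

lemma GL_mult_inv [simp]: "g \<in> GL \<Longrightarrow> g ** matrix_inv g = mat 1"
  by (metis GL_def GL_right_inverse(2) invertible_right_inverse mem_Collect_eq)

lemma GL_inv_mult [simp]: "g \<in> GL \<Longrightarrow> matrix_inv g ** g = mat 1"
  using GL_mult_inv matrix_left_right_inverse by blast

lemma GL_inv [simp]: "g \<in> GL \<Longrightarrow> matrix_inv g \<in> GL"
  by (rule GL_right_inverse(1)[OF GL_inv_mult])

lemma GL_mult [simp]: "g \<in> GL \<Longrightarrow> h \<in> GL \<Longrightarrow> g ** h \<in> GL"
  by (simp add: GL_def invertible_mult)

lemma GL_one [simp]: "mat 1 \<in> GL"
  by (rule GL_right_inverse(1)[of _ "mat 1"]) simp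

lemma GL_inv_mult_cancel_left [simp]: "g \<in> GL \<Longrightarrow> matrix_inv g ** (g ** x) = x"
  by (simp add: matrix_mul_assoc)

lemma GL_mult_inv_cancel_left [simp]: "g \<in> GL \<Longrightarrow> g ** (matrix_inv g ** x) = x"
  by (simp add: matrix_mul_assoc)

lemma GL_mult_inv_cancel_right [simp]: "g \<in> GL \<Longrightarrow> x ** g ** matrix_inv g = x"
  by (simp flip: matrix_mul_assoc)

lemma GL_inv_mult_cancel_right [simp]: "g \<in> GL \<Longrightarrow> x ** matrix_inv g ** g = x"
  by (simp flip: matrix_mul_assoc)

lemma matrix_inv_one [simp]: "matrix_inv (mat 1 :: 'a::field^'n^'n) = mat 1"
  by (rule GL_right_inverse(2)) simp

lemma matrix_inv_inv [simp]: "g \<in> GL \<Longrightarrow> matrix_inv (matrix_inv g) = g"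
  by (rule GL_right_inverse(2)) simp

lemma matrix_inv_mult: "g \<in> GL \<Longrightarrow> h \<in> GL \<Longrightarrow> matrix_inv (g ** h) = matrix_inv h ** matrix_inv g"
  by (rule GL_right_inverse(2)) (simp add: matrix_mul_assoc)

lemma GL_mult_left_iff: "g \<in> GL \<Longrightarrow> g ** x \<in> GL \<longleftrightarrow> x \<in> GL"
  by (metis GL_inv_mult_cancel_left GL_inv GL_mult)

lemma GL_uminus_iff [simp]: "- g \<in> GL \<longleftrightarrow> g \<in> GL"
proof -
  have "- h \<in> GL" if "h \<in> GL" for h :: "'a^'b^'b"
    using that by (intro GL_right_inverse(1)[of _ "- matrix_inv h"]) (simp add: matrix_ring_simps)
  from this[of g] this[of "- g"] show ?thesis
    by auto
qed

lemma matrix_inv_uminus: "g \<in> GL \<Longrightarrow> matrix_inv (- g) = - matrix_inv g"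
  by (rule GL_right_inverse(2)) (simp add: matrix_ring_simps)

lemma GL_conj_inv_eq:
  assumes "g \<in> GL" "x \<in> GL" "x ** g ** y = g"
  shows "matrix_inv g ** matrix_inv x ** g = y"
proof -
  have "matrix_inv x ** g = g ** y"
    using GL_inv_mult_cancel_left[of x "g ** y"] assms(2,3) by (simp add: matrix_mul_assoc)
  then show ?thesis
    using assms(1) by (simp flip: matrix_mul_assoc)
qed

definition upper_left :: "('a, 'k::finite) bmat \<Rightarrow> 'a^'k^'k" where
  "upper_left g = (\<chi> i j. g $ Inl i $ Inl j)"

definition upper_right :: "('a, 'k::finite) bmat \<Rightarrow> 'a^'k^'k" where
  "upper_right g = (\<chi> i j. g $ Inl i $ Inr j)"

definition lower_left :: "('a, 'k::finite) bmat \<Rightarrow> 'a^'k^'k" where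
  "lower_left g = (\<chi> i j. g $ Inr i $ Inl j)"

definition lower_right :: "('a, 'k::finite) bmat \<Rightarrow> 'a^'k^'k" where
  "lower_right g = (\<chi> i j. g $ Inr i $ Inr j)"

lemmas quadrant_defs = upper_left_def upper_right_def lower_left_def lower_right_def

lemma bmat_eq_iff:
  "g = h \<longleftrightarrow> upper_left g = upper_left h \<and> upper_right g = upper_right h \<and>
     lower_left g = lower_left h \<and> lower_right g = lower_right h"
  for g h :: "('a, 'k::finite) bmat"
  by (auto simp: vec_eq_iff quadrant_defs) (metis sum.exhaust)

lemma quadrant_block [simp]:
  "upper_left (block A B C D) = A" "upper_right (block A B C D) = B"
  "lower_left (block A B C D) = C" "lower_right (block A B C D) = D"
  by (simp_all add: vec_eq_iff quadrant_defs block_def)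

lemma block_eq_iff [simp]:
  "block A B C D = block A' B' C' D' \<longleftrightarrow> A = A' \<and> B = B' \<and> C = C' \<and> D = D'"
  by (simp add: bmat_eq_iff)

lemma quadrant_mult [simp]:
  fixes g h :: "('a::semiring_1, 'k::finite) bmat"
  shows "upper_left (g ** h) = upper_left g ** upper_left h + upper_right g ** lower_left h"
    and "upper_right (g ** h) = upper_left g ** upper_right h + upper_right g ** lower_right h"
    and "lower_left (g ** h) = lower_left g ** upper_left h + lower_right g ** lower_left h"
    and "lower_right (g ** h) = lower_left g ** upper_right h + lower_right g ** lower_right h"
  by (simp_all add: vec_eq_iff quadrant_defs matrix_matrix_mult_def sum.Plus flip: UNIV_Plus_UNIV)

lemma quadrant_one [simp]:
  "upper_left (mat 1) = (mat 1 :: 'a::semiring_1^'k::finite^'k)"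
  "upper_right (mat 1) = (0 :: 'a^'k^'k)"
  "lower_left (mat 1) = (0 :: 'a^'k^'k)" "lower_right (mat 1) = (mat 1 :: 'a^'k^'k)"
  by (simp_all add: vec_eq_iff quadrant_defs mat_def)

lemma block_mult [simp]:
  "block A B C D ** block A' B' C' D' =
     block (A ** A' + B ** C') (A ** B' + B ** D')
       (C ** A' + D ** C') (C ** B' + D ** (D' :: 'a::semiring_1^'k::finite^'k))"
  by (simp add: bmat_eq_iff)

lemma mat_one_eq_block: "(mat 1 :: ('a::semiring_1, 'k::finite) bmat) = block (mat 1) 0 0 (mat 1)"
  by (simp add: bmat_eq_iff)

abbreviation upper_unip :: "'a::field^'k^'k \<Rightarrow> ('a, 'k::finite) bmat" where
  "upper_unip B \<equiv> block (mat 1) B 0 (mat 1)"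

abbreviation lower_unip :: "'a::field^'k^'k \<Rightarrow> ('a, 'k::finite) bmat" where
  "lower_unip C \<equiv> block (mat 1) 0 C (mat 1)"

lemma upper_unip_mult_uminus: "upper_unip B ** upper_unip (- B) = mat 1"
  and lower_unip_mult_uminus: "lower_unip B ** lower_unip (- B) = mat 1"
  by (simp_all add: mat_one_eq_block)

lemmas GL_upper_unip [simp] = GL_right_inverse(1)[OF upper_unip_mult_uminus]
  and inv_upper_unip [simp] = GL_right_inverse(2)[OF upper_unip_mult_uminus]
  and GL_lower_unip [simp] = GL_right_inverse(1)[OF lower_unip_mult_uminus]
  and inv_lower_unip [simp] = GL_right_inverse(2)[OF lower_unip_mult_uminus]

lemma w_mat_mult_self [simp]: "w_mat ** w_mat = mat 1"
  by (simp add: w_mat_def mat_one_eq_block)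

lemmas GL_w_mat [simp] = GL_right_inverse(1)[OF w_mat_mult_self]
  and inv_w_mat [simp] = GL_right_inverse(2)[OF w_mat_mult_self]

lemma w_mat_cancel_right [simp]: "x ** w_mat ** w_mat = x"
  by (simp flip: matrix_mul_assoc)

lemma w_mat_conj_upper_unip: "w_mat ** upper_unip B ** w_mat = lower_unip B"
  by (simp add: w_mat_def)

lemma lower_unip_bruhat:
  assumes "C \<in> GL"
  shows "lower_unip C =
    upper_unip (matrix_inv C) ** block (- matrix_inv C) 0 0 C ** w_mat ** upper_unip (matrix_inv C)"
  using assms by (simp add: w_mat_def matrix_ring_simps)

lemma lower_unip_conj_upper_unip:
  "lower_unip C ** upper_unip B ** lower_unip (- C) =
    block (mat 1 - B ** C) B (- (C ** B ** C)) (mat 1 + C ** B)"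
  by (simp add: matrix_ring_simps)

section \<open>The Hecke algebra of a representation of a matrix group\<close>

locale matrix_group =
  fixes P :: "('a::field ^ 'n ^ 'n::finite) set"
  assumes mem_GL: "p \<in> P \<Longrightarrow> p \<in> GL"
    and one_mem: "mat 1 \<in> P"
    and mult_mem: "p \<in> P \<Longrightarrow> q \<in> P \<Longrightarrow> p ** q \<in> P"
    and inv_mem: "p \<in> P \<Longrightarrow> matrix_inv p \<in> P"
begin

definition coset :: "'a^'n^'n \<Rightarrow> ('a^'n^'n) set" where
  "coset h = (**) h ` P"

definition dcoset :: "'a^'n^'n \<Rightarrow> ('a^'n^'n) set" where
  "dcoset g = {p ** g ** q | p q. p \<in> P \<and> q \<in> P}"

lemma coset_self: "h \<in> coset h"
  using one_mem by (force simp: coset_def)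

lemma coset_mult_right:
  assumes p: "p \<in> P"
  shows "coset (h ** p) = coset h"
proof -
  have "(**) p ` P = P"
  proof (intro equalityI subsetI)
    fix x
    assume "x \<in> P"
    then have "matrix_inv p ** x \<in> P"
      using p by (simp add: inv_mem mult_mem)
    then show "x \<in> (**) p ` P"
      using p by (intro image_eqI[of _ _ "matrix_inv p ** x"]) (simp_all add: mem_GL)
  qed (use p mult_mem in blast)
  then have "(**) h ` (**) p ` P = (**) h ` P"
    by simp
  then show ?thesis
    by (simp add: coset_def image_image matrix_mul_assoc)
qed

lemma coset_eqI: "x \<in> coset h \<Longrightarrow> coset x = coset h"
  by (auto simp: coset_mult_right coset_def[of h])

lemma coset_mult_left: "coset (x ** h) = (**) x ` coset h"
  by (simp add: coset_def image_image matrix_mul_assoc)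

lemma coset_mult_left_eq_iff: "x \<in> GL \<Longrightarrow> coset (x ** g) = coset (x ** h) \<longleftrightarrow> coset g = coset h"
  by (metis GL_inv_mult_cancel_left coset_mult_left)

lemma coset_eqD: "h \<in> GL \<Longrightarrow> coset g = coset h \<Longrightarrow> matrix_inv h ** g \<in> P"
  using coset_self[of g] by (auto simp: coset_def)

lemma dcosetI: "p \<in> P \<Longrightarrow> q \<in> P \<Longrightarrow> p ** g ** q \<in> dcoset g"
  by (auto simp: dcoset_def)

lemma dcosetE:
  assumes "x \<in> dcoset g"
  obtains p q where "p \<in> P" "q \<in> P" "x = p ** g ** q"
  using assms by (auto simp: dcoset_def)

lemma dcoset_self: "g \<in> dcoset g"
  using dcosetI[OF one_mem one_mem, of g] by simp

lemma dcoset_GL: "x \<in> dcoset g \<Longrightarrow> g \<in> GL \<Longrightarrow> x \<in> GL"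
  by (auto elim!: dcosetE simp: mem_GL)

lemma dcoset_mult:
  assumes "x \<in> dcoset g" "p \<in> P" "q \<in> P"
  shows "p ** x ** q \<in> dcoset g"
proof -
  obtain p' q' where "p' \<in> P" "q' \<in> P" "x = p' ** g ** q'"
    using assms(1) by (rule dcosetE)
  then show ?thesis
    using assms dcosetI[of "p ** p'" "q' ** q" g] by (simp add: matrix_mul_assoc mult_mem)
qed

lemma dcoset_mult_left: "x \<in> dcoset g \<Longrightarrow> p \<in> P \<Longrightarrow> p ** x \<in> dcoset g"
  using dcoset_mult[of x g p "mat 1"] by (simp add: one_mem)

lemma dcoset_sym:
  assumes "x \<in> dcoset g"
  shows "g \<in> dcoset x"
proof -
  obtain p q where "p \<in> P" "q \<in> P" "x = p ** g ** q"
    using assms by (rule dcosetE)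
  then show ?thesis
    using dcosetI[of "matrix_inv p" "matrix_inv q" x] by (simp add: inv_mem mem_GL matrix_mul_assoc)
qed

lemma dcoset_trans: "x \<in> dcoset g \<Longrightarrow> g \<in> dcoset h \<Longrightarrow> x \<in> dcoset h"
  by (auto elim: dcosetE[of x g] intro: dcoset_mult)

lemma dcoset_eq: "x \<in> dcoset g \<Longrightarrow> dcoset x = dcoset g"
  using dcoset_sym dcoset_trans by blast

definition transversal :: "('a^'n^'n) set \<Rightarrow> ('a^'n^'n) set \<Rightarrow> bool" where
  "transversal S I \<longleftrightarrow> finite I \<and> I \<subseteq> S \<and> inj_on coset I \<and> S \<subseteq> (\<Union>i\<in>I. coset i)"

definition finite_cosets :: "('a^'n^'n) set \<Rightarrow> bool" where
  "finite_cosets S \<longleftrightarrow> finite (coset ` S)"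

lemma finite_cosets_subset: "finite_cosets S \<Longrightarrow> T \<subseteq> S \<Longrightarrow> finite_cosets T"
  unfolding finite_cosets_def by (rule finite_subset[OF image_mono])

lemma transversal_finite_cosets:
  assumes "transversal S I"
  shows "finite_cosets S"
proof -
  have "coset ` S \<subseteq> coset ` I"
  proof (rule image_subsetI)
    fix x
    assume "x \<in> S"
    then obtain i where "i \<in> I" "x \<in> coset i"
      using assms by (auto simp: transversal_def)
    then show "coset x \<in> coset ` I"
      by (simp add: coset_eqI)
  qed
  moreover have "finite (coset ` I)"
    using assms by (simp add: transversal_def)
  ultimately show ?thesis
    unfolding finite_cosets_def by (rule finite_subset)
qed

lemma finite_cosets_transversal:
  assumes "finite_cosets S"
  obtains I where "transversal S I"
proof -
  obtain I where I: "I \<subseteq> S" "inj_on coset I" "coset ` S = coset ` I"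
    by (metis subset_image_inj order_refl)
  moreover have "finite I"
    using assms I finite_image_iff unfolding finite_cosets_def by metis
  moreover have "S \<subseteq> (\<Union>i\<in>I. coset i)"
    unfolding I(3)[symmetric] using coset_self by blast
  ultimately show thesis
    using that by (auto simp: transversal_def)
qed

lemma transversal_mult_left:
  assumes S: "transversal S I" and p: "p \<in> GL" and inv: "(**) p ` S = S"
  shows "transversal S ((**) p ` I)"
proof -
  have "inj_on coset ((**) p ` I)"
    using S p by (auto simp: transversal_def inj_on_def coset_mult_left_eq_iff)
  moreover have "(**) p ` S \<subseteq> (\<Union>i\<in>(**) p ` I. coset i)"
    using S by (fastforce simp: transversal_def coset_mult_left)
  moreover have "(**) p ` I \<subseteq> (**) p ` S"
    using S by (auto simp: transversal_def)
  ultimately show ?thesis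
    using S inv by (simp add: transversal_def)
qed

lemma finite_cosets_dcoset_normalizer:
  assumes y: "y \<in> GL" and norm: "\<And>p. p \<in> P \<Longrightarrow> matrix_inv y ** p ** y \<in> P"
  shows "finite_cosets (dcoset y)"
proof -
  have "coset x = coset y" if "x \<in> dcoset y" for x
  proof -
    obtain p q where pq: "p \<in> P" "q \<in> P" "x = p ** y ** q"
      using \<open>x \<in> dcoset y\<close> by (rule dcosetE)
    then have "x = y ** (matrix_inv y ** p ** y ** q)"
      using y by (simp add: matrix_mul_assoc)
    moreover have "matrix_inv y ** p ** y ** q \<in> P"
      using pq by (intro mult_mem norm)
    ultimately show ?thesis
      using coset_mult_right by simp
  qed
  then have "coset ` dcoset y \<subseteq> {coset y}"
    by blast
  then show ?thesis
    unfolding finite_cosets_def by (rule finite_subset) simp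
qed

lemma finite_cosets_dcoset_mult:
  assumes "finite_cosets (dcoset x)" "finite_cosets (dcoset y)"
  shows "finite_cosets (dcoset (x ** y))"
proof -
  obtain I where "transversal (dcoset x) I"
    using finite_cosets_transversal[OF assms(1)] .
  then have I: "finite I" "dcoset x \<subseteq> (\<Union>i\<in>I. coset i)"
    by (simp_all add: transversal_def)
  have "coset z \<in> (\<Union>i\<in>I. (`) ((**) i) ` coset ` dcoset y)" if "z \<in> dcoset (x ** y)" for z
  proof -
    obtain p q where pq: "p \<in> P" "q \<in> P" "z = p ** (x ** y) ** q"
      using \<open>z \<in> dcoset (x ** y)\<close> by (rule dcosetE)
    obtain i p' where i: "i \<in> I" "p' \<in> P" "p ** x = i ** p'"
      using I(2) dcoset_mult_left[OF dcoset_self pq(1)] by (fastforce simp: coset_def)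
    have "z = i ** (p' ** y ** q)"
      using pq i by (simp add: matrix_mul_assoc)
    then have "coset z = (**) i ` coset (p' ** y ** q)"
      by (simp only: coset_mult_left)
    then show ?thesis
      using UN_I[OF i(1)] dcosetI[OF i(2) pq(2)] by (metis (lifting) imageI)
  qed
  then have "coset ` dcoset (x ** y) \<subseteq> (\<Union>i\<in>I. (`) ((**) i) ` coset ` dcoset y)"
    by blast
  moreover have "finite (\<Union>i\<in>I. (`) ((**) i) ` coset ` dcoset y)"
    using assms(2) unfolding finite_cosets_def by (blast intro: finite_UN_I[OF I(1)] finite_imageI)
  ultimately show ?thesis
    unfolding finite_cosets_def by (rule finite_subset)
qed

text \<open>The two conditions on a pair of elements under which their double cosets multiply as freely as
  possible; in the affine Weyl group they amount to additivity of lengths.\<close>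

definition additive_pair :: "'a^'n^'n \<Rightarrow> 'a^'n^'n \<Rightarrow> bool" where
  "additive_pair \<eta> \<delta> \<longleftrightarrow> \<eta> \<in> GL \<and> \<delta> \<in> GL \<and>
     (\<forall>q\<in>P. \<exists>x\<in>P. \<exists>y. q = x ** y \<and> \<eta> ** x ** matrix_inv \<eta> \<in> P \<and> matrix_inv \<delta> ** y ** \<delta> \<in> P) \<and>
     (\<forall>p\<in>P. matrix_inv (\<eta> ** \<delta>) ** p ** (\<eta> ** \<delta>) \<in> P \<longrightarrow> matrix_inv \<eta> ** p ** \<eta> \<in> P)"

lemma additive_pair_GL: "additive_pair \<eta> \<delta> \<Longrightarrow> \<eta> \<in> GL" "additive_pair \<eta> \<delta> \<Longrightarrow> \<delta> \<in> GL"
  by (simp_all add: additive_pair_def)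

lemma additive_pair_slide:
  assumes "additive_pair \<eta> \<delta>" "q \<in> P"
  obtains x y where "x \<in> P" "y \<in> P" "matrix_inv \<eta> ** x ** \<eta> \<in> P" "\<eta> ** q ** \<delta> = x ** (\<eta> ** \<delta>) ** y"
proof -
  obtain x y where xy: "x \<in> P" "q = x ** y" "\<eta> ** x ** matrix_inv \<eta> \<in> P"
      "matrix_inv \<delta> ** y ** \<delta> \<in> P"
    using assms by (auto simp: additive_pair_def)
  show thesis
  proof (rule that[OF xy(3,4)])
    show "matrix_inv \<eta> ** (\<eta> ** x ** matrix_inv \<eta>) ** \<eta> \<in> P"
      using xy additive_pair_GL[OF assms(1)] by (simp add: matrix_mul_assoc)
    show "\<eta> ** q ** \<delta> = \<eta> ** x ** matrix_inv \<eta> ** (\<eta> ** \<delta>) ** (matrix_inv \<delta> ** y ** \<delta>)"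
      using xy(2) additive_pair_GL[OF assms(1)] by (simp add: matrix_mul_assoc)
  qed
qed

lemma additive_pair_dcoset_mult:
  assumes ad: "additive_pair \<eta> \<delta>" and "g \<in> dcoset \<eta>" "h \<in> dcoset \<delta>"
  shows "g ** h \<in> dcoset (\<eta> ** \<delta>)"
proof -
  obtain p q p' q' where pq: "p \<in> P" "q \<in> P" "g = p ** \<eta> ** q" "p' \<in> P" "q' \<in> P" "h = p' ** \<delta> ** q'"
    using assms(2,3) by (elim dcosetE)
  obtain x y where xy: "x \<in> P" "y \<in> P" "\<eta> ** (q ** p') ** \<delta> = x ** (\<eta> ** \<delta>) ** y"
    using additive_pair_slide[OF ad mult_mem[OF pq(2,4)]] by metis
  have "g ** h = p ** (\<eta> ** (q ** p') ** \<delta>) ** q'"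
    by (simp add: pq matrix_mul_assoc)
  then show ?thesis
    using pq xy by (simp add: dcoset_mult dcosetI)
qed

lemma additive_pair_coset_unique:
  assumes ad: "additive_pair \<eta> \<delta>" and g: "g \<in> dcoset \<eta>" and "matrix_inv g ** (\<eta> ** \<delta>) \<in> dcoset \<delta>"
  shows "coset g = coset \<eta>"
proof -
  note GL = additive_pair_GL[OF ad]
  obtain p q where pq: "p \<in> P" "q \<in> P" "g = p ** \<eta> ** q"
    using g by (rule dcosetE)
  obtain p' q' where pq': "p' \<in> P" "q' \<in> P" "matrix_inv g ** (\<eta> ** \<delta>) = p' ** \<delta> ** q'"
    using assms(3) by (rule dcosetE)
  obtain x y where xy: "x \<in> P" "y \<in> P" "matrix_inv \<eta> ** x ** \<eta> \<in> P"
      "\<eta> ** (q ** p') ** \<delta> = x ** (\<eta> ** \<delta>) ** y"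
    using additive_pair_slide[OF ad mult_mem[OF pq(2) pq'(1)]] by metis
  have "\<eta> ** \<delta> = g ** (matrix_inv g ** (\<eta> ** \<delta>))"
    using dcoset_GL[OF g GL(1)] by simp
  also have "\<dots> = p ** (\<eta> ** (q ** p') ** \<delta>) ** q'"
    unfolding pq'(3) by (simp add: pq matrix_mul_assoc)
  also have "\<dots> = (p ** x) ** (\<eta> ** \<delta>) ** (y ** q')"
    unfolding xy(4) by (simp only: matrix_mul_assoc)
  finally have fixed: "\<eta> ** \<delta> = (p ** x) ** (\<eta> ** \<delta>) ** (y ** q')" .
  have px: "p ** x \<in> P" and yq: "y ** q' \<in> P"
    using pq pq' xy by (simp_all add: mult_mem)
  have "matrix_inv (\<eta> ** \<delta>) ** matrix_inv (p ** x) ** (\<eta> ** \<delta>) = y ** q'"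
    using GL mem_GL[OF px] by (intro GL_conj_inv_eq fixed[symmetric]) simp_all
  then have "matrix_inv \<eta> ** matrix_inv (p ** x) ** \<eta> \<in> P"
    using ad inv_mem[OF px] yq by (simp add: additive_pair_def)
  from inv_mem[OF this] have "matrix_inv \<eta> ** p ** x ** \<eta> \<in> P"
    using GL mem_GL[OF px] by (simp add: matrix_inv_mult matrix_mul_assoc)
  from mult_mem[OF this inv_mem[OF xy(3)]] have "matrix_inv \<eta> ** p ** \<eta> \<in> P"
    using GL xy(1) by (simp add: matrix_inv_mult mem_GL matrix_mul_assoc)
  moreover have "g = \<eta> ** (matrix_inv \<eta> ** p ** \<eta> ** q)"
    using GL by (simp add: pq matrix_mul_assoc)
  ultimately show ?thesis
    using pq(2) coset_mult_right mult_mem by simp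
qed

end

locale hecke_pair = matrix_group P
  for P :: "('a::field ^ 'n ^ 'n::finite) set" +
  fixes smul :: "'r::field \<Rightarrow> 'v::ab_group_add \<Rightarrow> 'v"
    and \<rho> :: "'a ^ 'n ^ 'n \<Rightarrow> 'v \<Rightarrow> 'v"
  assumes vector_space: "vector_space smul"
    and rho_linear: "p \<in> P \<Longrightarrow> Vector_Spaces.linear smul smul (\<rho> p)"
    and rho_one: "\<rho> (mat 1) = id"
    and rho_mult: "p \<in> P \<Longrightarrow> q \<in> P \<Longrightarrow> \<rho> (p ** q) = \<rho> p \<circ> \<rho> q"
begin

sublocale V: vector_space_pair smul smul
  by (intro vector_space_pair.intro vector_space)

abbreviation linear :: "('v \<Rightarrow> 'v) \<Rightarrow> bool" where
  "linear \<equiv> Vector_Spaces.linear smul smul"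


lemma rho_inv_cancel:
  assumes "p \<in> P"
  shows "\<rho> p (\<rho> (matrix_inv p) v) = v" "\<rho> (matrix_inv p) (\<rho> p v) = v"
  using assms rho_mult[of p "matrix_inv p"] rho_mult[of "matrix_inv p" p]
  by (simp_all add: inv_mem mem_GL rho_one fun_eq_iff)

definition support :: "('a^'n^'n \<Rightarrow> 'v \<Rightarrow> 'v) \<Rightarrow> ('a^'n^'n) set" where
  "support \<phi> = {g. \<phi> g \<noteq> (\<lambda>_. 0)}"

definition biequivariant :: "('a^'n^'n \<Rightarrow> 'v \<Rightarrow> 'v) \<Rightarrow> bool" where
  "biequivariant \<phi> \<longleftrightarrow> support \<phi> \<subseteq> GL \<and> (\<forall>g\<in>GL. linear (\<phi> g)) \<and>
     (\<forall>g\<in>GL. \<forall>p\<in>P. \<forall>q\<in>P. \<phi> (p ** g ** q) = \<rho> p \<circ> \<phi> g \<circ> \<rho> q)"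

lemma notin_support: "g \<notin> support \<phi> \<Longrightarrow> \<phi> g = (\<lambda>_. 0)"
  by (simp add: support_def)

lemma biequivariant_not_GL: "biequivariant \<phi> \<Longrightarrow> g \<notin> GL \<Longrightarrow> \<phi> g = (\<lambda>_. 0)"
  by (auto simp: biequivariant_def support_def)

lemma biequivariant_linear: "biequivariant \<phi> \<Longrightarrow> g \<in> GL \<Longrightarrow> linear (\<phi> g)"
  by (simp add: biequivariant_def)

lemma biequivariant_zero: "biequivariant \<phi> \<Longrightarrow> \<phi> g 0 = 0"
  by (cases "g \<in> GL") (auto simp: biequivariant_not_GL dest: biequivariant_linear V.linear_0)

lemma biequivariant_mult:
  "biequivariant \<phi> \<Longrightarrow> g \<in> GL \<Longrightarrow> p \<in> P \<Longrightarrow> q \<in> P \<Longrightarrow> \<phi> (p ** g ** q) = \<rho> p \<circ> \<phi> g \<circ> \<rho> q"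
  by (simp add: biequivariant_def)

lemma biequivariant_left: "biequivariant \<phi> \<Longrightarrow> g \<in> GL \<Longrightarrow> p \<in> P \<Longrightarrow> \<phi> (p ** g) = \<rho> p \<circ> \<phi> g"
  using biequivariant_mult[of \<phi> g p "mat 1"] by (simp add: one_mem rho_one)

lemma biequivariant_right: "biequivariant \<phi> \<Longrightarrow> g \<in> GL \<Longrightarrow> q \<in> P \<Longrightarrow> \<phi> (g ** q) = \<phi> g \<circ> \<rho> q"
  using biequivariant_mult[of \<phi> g "mat 1" q] by (simp add: one_mem rho_one)

lemma biequivariant_dcoset_support:
  assumes "biequivariant \<phi>" "g \<in> GL" "x \<in> dcoset g" "x \<in> support \<phi>"
  shows "g \<in> support \<phi>"
proof (rule ccontr)
  assume "g \<notin> support \<phi>"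
  then have "\<phi> x = (\<lambda>_. 0)"
    using assms(1-3)
    by (auto elim!: dcosetE simp: biequivariant_mult notin_support fun_eq_iff rho_linear V.linear_0)
  with assms(4) show False
    by (simp add: support_def)
qed

text \<open>\<open>elementary \<eta> f \<phi>\<close> says that \<open>\<phi>\<close> is the function written \<open>[\<eta>]\<^sub>f\<close>.\<close>

definition elementary :: "'a^'n^'n \<Rightarrow> ('v \<Rightarrow> 'v) \<Rightarrow> ('a^'n^'n \<Rightarrow> 'v \<Rightarrow> 'v) \<Rightarrow> bool" where
  "elementary \<eta> f \<phi> \<longleftrightarrow> \<eta> \<in> GL \<and> biequivariant \<phi> \<and> support \<phi> \<subseteq> dcoset \<eta> \<and> \<phi> \<eta> = f"

lemma elementary_biequivariant: "elementary \<eta> f \<phi> \<Longrightarrow> biequivariant \<phi>"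
  by (simp add: elementary_def)

lemma elementary_GL: "elementary \<eta> f \<phi> \<Longrightarrow> \<eta> \<in> GL"
  by (simp add: elementary_def)

lemma elementary_support: "elementary \<eta> f \<phi> \<Longrightarrow> support \<phi> \<subseteq> dcoset \<eta>"
  by (simp add: elementary_def)

lemma elementary_self: "elementary \<eta> f \<phi> \<Longrightarrow> \<phi> \<eta> = f"
  by (simp add: elementary_def)

lemma elementary_outside: "elementary \<eta> f \<phi> \<Longrightarrow> g \<notin> dcoset \<eta> \<Longrightarrow> \<phi> g = (\<lambda>_. 0)"
  by (auto simp: elementary_def support_def)

lemma elementary_mult: "elementary \<eta> f \<phi> \<Longrightarrow> p \<in> P \<Longrightarrow> q \<in> P \<Longrightarrow> \<phi> (p ** \<eta> ** q) = \<rho> p \<circ> f \<circ> \<rho> q"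
  by (auto simp: elementary_def biequivariant_mult)

lemma elementary_unique:
  assumes "elementary \<eta> f \<phi>" "elementary \<eta> f \<psi>"
  shows "\<phi> = \<psi>"
proof
  fix g
  show "\<phi> g = \<psi> g"
    using assms
    by (cases "g \<in> dcoset \<eta>") (auto elim!: dcosetE simp: elementary_mult elementary_outside)
qed

lemma elementary_scale:
  assumes "elementary \<eta> f \<phi>"
  shows "elementary \<eta> (\<lambda>v. smul c (f v)) (\<lambda>g v. smul c (\<phi> g v))"
proof -
  have "support (\<lambda>g v. smul c (\<phi> g v)) \<subseteq> support \<phi>"
    by (auto simp: support_def V.vs1.scale_zero_right)
  moreover have "linear (\<lambda>v. smul c (\<phi> g v))" if "g \<in> GL" for g
    using assms that
    by (intro V.linear_compose_scale_right) (auto simp: elementary_def biequivariant_def)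
  ultimately show ?thesis
    using assms
    by (auto simp: elementary_def biequivariant_def fun_eq_iff rho_linear V.linear_scale)
qed

lemma biequivariant_eq_elementary_sum:
  assumes \<Theta>: "biequivariant \<Theta>" and supp: "support \<Theta> \<subseteq> dcoset x \<union> dcoset y" and disj: "x \<notin> dcoset y"
    and \<phi>: "elementary x (\<Theta> x) \<phi>" and \<psi>: "elementary y (\<Theta> y) \<psi>"
  shows "\<Theta> = (\<lambda>g v. \<phi> g v + \<psi> g v)"
proof (intro ext)
  fix g v
  consider (in_x) "g \<in> dcoset x" | (in_y) "g \<in> dcoset y" | (outside) "g \<notin> dcoset x" "g \<notin> dcoset y"
    by blast
  then show "\<Theta> g v = \<phi> g v + \<psi> g v"
  proof cases
    case in_x
    then have "g \<notin> dcoset y"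
      using disj dcoset_sym dcoset_trans by blast
    moreover have "\<Theta> g = \<phi> g"
      using in_x \<Theta> \<phi> by (auto elim!: dcosetE simp: elementary_mult biequivariant_mult elementary_GL)
    ultimately show ?thesis
      by (simp add: elementary_outside[OF \<psi>])
  next
    case in_y
    then have "g \<notin> dcoset x"
      using disj dcoset_sym dcoset_trans by blast
    moreover have "\<Theta> g = \<psi> g"
      using in_y \<Theta> \<psi> by (auto elim!: dcosetE simp: elementary_mult biequivariant_mult elementary_GL)
    ultimately show ?thesis
      by (simp add: elementary_outside[OF \<phi>])
  next
    case outside
    then have "\<Theta> g = (\<lambda>_. 0)"
      using supp notin_support by blast
    with outside show ?thesis
      by (simp add: elementary_outside[OF \<phi>] elementary_outside[OF \<psi>])
  qed
qed

lemma intertwiner_translate_eq: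
  assumes \<eta>: "\<eta> \<in> GL"
    and f: "\<And>x. x \<in> P \<Longrightarrow> \<eta> ** x ** matrix_inv \<eta> \<in> P \<Longrightarrow> f \<circ> \<rho> x = \<rho> (\<eta> ** x ** matrix_inv \<eta>) \<circ> f"
    and pq: "p \<in> P" "q \<in> P" "p' \<in> P" "q' \<in> P" and same: "p ** \<eta> ** q = p' ** \<eta> ** q'"
  shows "\<rho> p \<circ> f \<circ> \<rho> q = \<rho> p' \<circ> f \<circ> \<rho> q'"
proof -
  define x where "x = q ** matrix_inv q'"
  define y where "y = matrix_inv p ** p'"
  have xy: "x \<in> P" "y \<in> P"
    using pq by (simp_all add: x_def y_def mult_mem inv_mem)
  have "\<eta> ** x = matrix_inv p ** (p ** \<eta> ** q) ** matrix_inv q'"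
    using pq by (simp add: x_def mem_GL matrix_mul_assoc)
  also have "\<dots> = y ** \<eta>"
    using pq by (simp add: y_def same mem_GL matrix_mul_assoc)
  finally have "\<eta> ** x ** matrix_inv \<eta> = y"
    using \<eta> by simp
  with f xy have f_xy: "f \<circ> \<rho> x = \<rho> y \<circ> f"
    by simp
  have "\<rho> q = \<rho> x \<circ> \<rho> q'"
    using pq xy by (simp add: x_def mem_GL flip: rho_mult)
  moreover have "\<rho> p' = \<rho> p \<circ> \<rho> y"
    using pq xy by (simp add: y_def mem_GL flip: rho_mult)
  ultimately show ?thesis
    using f_xy by (simp add: fun_eq_iff)
qed

lemma elementaryI:
  assumes \<eta>: "\<eta> \<in> GL" and lin: "linear f" and supp: "support \<phi> \<subseteq> dcoset \<eta>"
    and \<phi>_mult: "\<And>p q. p \<in> P \<Longrightarrow> q \<in> P \<Longrightarrow> \<phi> (p ** \<eta> ** q) = \<rho> p \<circ> f \<circ> \<rho> q"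
  shows "elementary \<eta> f \<phi>"
proof -
  have zero: "\<phi> g = (\<lambda>_. 0)" if "g \<notin> dcoset \<eta>" for g
    using that supp notin_support by blast
  have "\<phi> (p ** g ** q) = \<rho> p \<circ> \<phi> g \<circ> \<rho> q" if pq: "p \<in> P" "q \<in> P" for g p q
  proof (cases "g \<in> dcoset \<eta>")
    case True
    then obtain p' q' where g: "p' \<in> P" "q' \<in> P" "g = p' ** \<eta> ** q'"
      by (rule dcosetE)
    then have "p ** g ** q = (p ** p') ** \<eta> ** (q' ** q)"
      by (simp add: matrix_mul_assoc)
    then show ?thesis
      using pq g by (simp add: \<phi>_mult mult_mem rho_mult o_assoc)
  next
    case False
    then have "p ** g ** q \<notin> dcoset \<eta>"
      using dcoset_trans[OF dcoset_sym[OF dcosetI[OF pq]]] by blast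
    with False pq show ?thesis
      by (simp add: zero fun_eq_iff rho_linear V.linear_0)
  qed
  moreover have "linear (\<phi> g)" for g
    using lin by (cases "g \<in> dcoset \<eta>")
      (auto elim!: dcosetE simp: \<phi>_mult zero V.module_hom_zero
        intro!: Vector_Spaces.linear_compose rho_linear)
  moreover have "\<phi> \<eta> = f"
    using \<phi>_mult[OF one_mem one_mem] by (simp add: rho_one)
  ultimately show ?thesis
    using \<eta> supp dcoset_GL by (auto simp: elementary_def biequivariant_def)
qed

lemma elementary_exists:
  assumes \<eta>: "\<eta> \<in> GL" and lin: "linear f"
    and f: "\<And>x. x \<in> P \<Longrightarrow> \<eta> ** x ** matrix_inv \<eta> \<in> P \<Longrightarrow> f \<circ> \<rho> x = \<rho> (\<eta> ** x ** matrix_inv \<eta>) \<circ> f"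
  shows "\<exists>\<phi>. elementary \<eta> f \<phi>"
proof -
  have "\<forall>g\<in>dcoset \<eta>. \<exists>p q. p \<in> P \<and> q \<in> P \<and> g = p ** \<eta> ** q"
    by (auto simp: dcoset_def)
  then obtain l r where lr: "\<forall>g\<in>dcoset \<eta>. l g \<in> P \<and> r g \<in> P \<and> g = l g ** \<eta> ** r g"
    by metis
  define \<phi> where "\<phi> g = (if g \<in> dcoset \<eta> then \<rho> (l g) \<circ> f \<circ> \<rho> (r g) else (\<lambda>_. 0))" for g
  have "elementary \<eta> f \<phi>"
  proof (rule elementaryI[OF \<eta> lin])
    show "support \<phi> \<subseteq> dcoset \<eta>"
      by (auto simp: support_def \<phi>_def)
    fix p q
    assume pq: "p \<in> P" "q \<in> P"
    define g where "g = p ** \<eta> ** q"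
    have g: "g \<in> dcoset \<eta>"
      using pq by (simp add: g_def dcosetI)
    with lr have "l g \<in> P" "r g \<in> P" "l g ** \<eta> ** r g = p ** \<eta> ** q"
      by (auto simp: g_def)
    then have "\<rho> (l g) \<circ> f \<circ> \<rho> (r g) = \<rho> p \<circ> f \<circ> \<rho> q"
      using pq by (intro intertwiner_translate_eq[OF \<eta> f])
    with g show "\<phi> (p ** \<eta> ** q) = \<rho> p \<circ> f \<circ> \<rho> q"
      by (simp add: \<phi>_def flip: g_def)
  qed
  then show ?thesis
    by blast
qed

definition conv :: "('a^'n^'n \<Rightarrow> 'v \<Rightarrow> 'v) \<Rightarrow> ('a^'n^'n \<Rightarrow> 'v \<Rightarrow> 'v) \<Rightarrow> 'a^'n^'n \<Rightarrow> 'v \<Rightarrow> 'v" where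
  "conv \<phi> \<psi> g v = (\<Sum>C\<in>{coset h | h. h \<in> GL \<and> coset h \<inter> support \<phi> \<noteq> {}}.
     let h = (SOME h. h \<in> C) in \<phi> h (\<psi> (matrix_inv h ** g) v))"

lemma conv_summand_mult:
  assumes "biequivariant \<phi>" "biequivariant \<psi>" "h \<in> GL" "p \<in> P"
  shows "\<phi> (h ** p) (\<psi> (matrix_inv (h ** p) ** g) v) = \<phi> h (\<psi> (matrix_inv h ** g) v)"
proof (cases "g \<in> GL")
  case True
  have "matrix_inv (h ** p) ** g = matrix_inv p ** (matrix_inv h ** g)"
    using assms by (simp add: matrix_inv_mult mem_GL matrix_mul_assoc)
  then show ?thesis
    using assms True by (simp add: biequivariant_right biequivariant_left inv_mem rho_inv_cancel)
next
  case False
  have "matrix_inv (h ** p) ** g \<notin> GL" "matrix_inv h ** g \<notin> GL"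
    using assms False by (simp_all add: GL_mult_left_iff mem_GL)
  then show ?thesis
    using assms by (simp add: biequivariant_not_GL biequivariant_zero)
qed

lemma conv_summand_coset:
  assumes "biequivariant \<phi>" "biequivariant \<psi>" "i \<in> GL" "h \<in> coset i"
  shows "\<phi> h (\<psi> (matrix_inv h ** g) v) = \<phi> i (\<psi> (matrix_inv i ** g) v)"
  using assms by (auto simp: coset_def conv_summand_mult)

lemma cosets_meeting_support:
  assumes \<phi>: "biequivariant \<phi>" and I: "transversal S I" and S: "support \<phi> \<subseteq> S" "S \<subseteq> GL"
  shows "{coset h | h. h \<in> GL \<and> coset h \<inter> support \<phi> \<noteq> {}} = coset ` (I \<inter> support \<phi>)"
proof (intro equalityI subsetI)
  have coset_support: "coset i \<inter> support \<phi> \<noteq> {} \<longleftrightarrow> i \<in> support \<phi>" if "i \<in> GL" for i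
    using \<phi> that coset_self[of i]
    by (auto simp: coset_def support_def biequivariant_right fun_eq_iff)
  fix C
  show "C \<in> coset ` (I \<inter> support \<phi>)" if C: "C \<in> {coset h | h. h \<in> GL \<and> coset h \<inter> support \<phi> \<noteq> {}}"
  proof -
    obtain h h' where h: "C = coset h" "h' \<in> coset h" "h' \<in> support \<phi>"
      using C by blast
    then obtain i where i: "i \<in> I" "h' \<in> coset i"
      using I S(1) by (fastforce simp: transversal_def)
    then have "C = coset i"
      using h coset_eqI by blast
    moreover have "i \<in> GL"
      using i(1) I S(2) by (auto simp: transversal_def)
    ultimately show ?thesis
      using h i coset_support by blast
  qed
  show "C \<in> {coset h | h. h \<in> GL \<and> coset h \<inter> support \<phi> \<noteq> {}}" if C: "C \<in> coset ` (I \<inter> support \<phi>)"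
    using C S coset_support by blast
qed

lemma conv_eq_sum:
  assumes \<phi>: "biequivariant \<phi>" and \<psi>: "biequivariant \<psi>" and I: "transversal S I"
    and S: "support \<phi> \<subseteq> S" "S \<subseteq> GL"
  shows "conv \<phi> \<psi> g v = (\<Sum>i\<in>I. \<phi> i (\<psi> (matrix_inv i ** g) v))"
proof -
  have "i \<in> GL" if "i \<in> I" for i
    using that I S by (auto simp: transversal_def)
  note summand = conv_summand_coset[OF \<phi> \<psi> this]
  have "conv \<phi> \<psi> g v =
      (\<Sum>i\<in>I \<inter> support \<phi>. let h = SOME h. h \<in> coset i in \<phi> h (\<psi> (matrix_inv h ** g) v))"
    unfolding conv_def cosets_meeting_support[OF \<phi> I S]
    using I by (simp add: sum.reindex transversal_def inj_on_Int)
  also have "\<dots> = (\<Sum>i\<in>I \<inter> support \<phi>. \<phi> i (\<psi> (matrix_inv i ** g) v))"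
    using summand someI[of "\<lambda>h. h \<in> coset _", OF coset_self]
    by (intro sum.cong refl) (simp add: Let_def)
  also have "\<dots> = (\<Sum>i\<in>I. \<phi> i (\<psi> (matrix_inv i ** g) v))"
    using I by (intro sum.mono_neutral_left) (auto simp: transversal_def notin_support)
  finally show ?thesis .
qed

lemma support_conv_eq_sum:
  assumes "biequivariant \<phi>" "biequivariant \<psi>" "transversal (support \<phi>) I"
  shows "conv \<phi> \<psi> g v = (\<Sum>i\<in>I. \<phi> i (\<psi> (matrix_inv i ** g) v))"
  using assms by (intro conv_eq_sum[OF assms]) (auto simp: biequivariant_def)

lemma support_conv:
  assumes \<phi>: "biequivariant \<phi>" and \<psi>: "biequivariant \<psi>" and fin: "finite_cosets (support \<phi>)"
    and g: "g \<in> support (conv \<phi> \<psi>)"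
  obtains h x where "h \<in> support \<phi>" "x \<in> support \<psi>" "g = h ** x"
proof -
  obtain I where I: "transversal (support \<phi>) I"
    using finite_cosets_transversal[OF fin] .
  obtain v where "conv \<phi> \<psi> g v \<noteq> 0"
    using g by (auto simp: support_def)
  then obtain i where i: "i \<in> I" "\<phi> i (\<psi> (matrix_inv i ** g) v) \<noteq> 0"
    unfolding support_conv_eq_sum[OF \<phi> \<psi> I] by (rule sum.not_neutral_contains_not_neutral)
  then have "i \<in> support \<phi>" "matrix_inv i ** g \<in> support \<psi>"
    using biequivariant_zero[OF \<phi>] by (auto simp: support_def)
  moreover from this have "g = i ** (matrix_inv i ** g)"
    using \<phi> by (auto simp: biequivariant_def)
  ultimately show thesis
    using that by blast
qed

lemma conv_mult_left:
  assumes \<phi>: "biequivariant \<phi>" and \<psi>: "biequivariant \<psi>" and fin: "finite_cosets (support \<phi>)"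
    and p: "p \<in> P"
  shows "conv \<phi> \<psi> (p ** g) v = \<rho> p (conv \<phi> \<psi> g v)"
proof -
  obtain I where I: "transversal (support \<phi>) I"
    using finite_cosets_transversal[OF fin] .
  then have IGL: "i \<in> GL" if "i \<in> I" for i
    using that \<phi> by (auto simp: transversal_def biequivariant_def)
  have pGL: "p \<in> GL"
    using p by (rule mem_GL)
  have mult_support: "q ** h \<in> support \<phi>" if "q \<in> P" "h \<in> support \<phi>" for q h
    using that \<phi> biequivariant_dcoset_support[of \<phi> "q ** h" h]
      dcosetI[OF inv_mem one_mem, of q "q ** h"]
    by (auto simp: biequivariant_def mem_GL)
  have "(**) p ` support \<phi> = support \<phi>"
  proof (intro equalityI subsetI)
    fix h
    assume "h \<in> support \<phi>"
    then have "matrix_inv p ** h \<in> support \<phi>"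
      using mult_support[OF inv_mem[OF p]] by blast
    then show "h \<in> (**) p ` support \<phi>"
      using pGL by (intro image_eqI[of _ _ "matrix_inv p ** h"]) simp_all
  qed (use mult_support p in blast)
  then have pI: "transversal (support \<phi>) ((**) p ` I)"
    by (rule transversal_mult_left[OF I pGL])
  have "inj_on ((**) p) I"
    using pGL by (metis GL_inv_mult_cancel_left inj_onI)
  then have "conv \<phi> \<psi> (p ** g) v = (\<Sum>i\<in>I. \<phi> (p ** i) (\<psi> (matrix_inv (p ** i) ** (p ** g)) v))"
    unfolding support_conv_eq_sum[OF \<phi> \<psi> pI] by (simp add: sum.reindex)
  also have "\<dots> = (\<Sum>i\<in>I. \<rho> p (\<phi> i (\<psi> (matrix_inv i ** g) v)))"
    using IGL pGL p \<phi>
    by (intro sum.cong refl) (simp add: biequivariant_left matrix_inv_mult matrix_mul_assoc)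
  also have "\<dots> = \<rho> p (conv \<phi> \<psi> g v)"
    unfolding support_conv_eq_sum[OF \<phi> \<psi> I] by (rule V.linear_sum[OF rho_linear[OF p], symmetric])
  finally show ?thesis .
qed

lemma conv_mult_right:
  assumes \<phi>: "biequivariant \<phi>" and \<psi>: "biequivariant \<psi>" and fin: "finite_cosets (support \<phi>)"
    and q: "q \<in> P" and g: "g \<in> GL"
  shows "conv \<phi> \<psi> (g ** q) v = conv \<phi> \<psi> g (\<rho> q v)"
proof -
  obtain I where I: "transversal (support \<phi>) I"
    using finite_cosets_transversal[OF fin] .
  then have IGL: "i \<in> GL" if "i \<in> I" for i
    using that \<phi> by (auto simp: transversal_def biequivariant_def)
  have "\<psi> (matrix_inv i ** (g ** q)) v = \<psi> (matrix_inv i ** g) (\<rho> q v)" if "i \<in> I" for i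
    using biequivariant_right[OF \<psi> _ q, of "matrix_inv i ** g"] g IGL[OF that]
    by (simp add: matrix_mul_assoc)
  then show ?thesis
    by (simp add: support_conv_eq_sum[OF \<phi> \<psi> I])
qed

lemma biequivariant_conv:
  assumes \<phi>: "biequivariant \<phi>" and \<psi>: "biequivariant \<psi>" and fin: "finite_cosets (support \<phi>)"
  shows "biequivariant (conv \<phi> \<psi>)"
proof -
  obtain I where I: "transversal (support \<phi>) I"
    using finite_cosets_transversal[OF fin] .
  then have IGL: "i \<in> GL" if "i \<in> I" for i
    using that \<phi> by (auto simp: transversal_def biequivariant_def)
  have "linear (conv \<phi> \<psi> g)" if "g \<in> GL" for g
  proof -
    have "linear (\<lambda>v. \<phi> i (\<psi> (matrix_inv i ** g) v))" if "i \<in> I" for i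
      using Vector_Spaces.linear_compose[OF biequivariant_linear[OF \<psi>]
            biequivariant_linear[OF \<phi>], of "matrix_inv i ** g" i] IGL[OF that] \<open>g \<in> GL\<close> by (simp add: o_def)
    then have "linear (\<lambda>v. \<Sum>i\<in>I. \<phi> i (\<psi> (matrix_inv i ** g) v))"
      by (intro V.linear_compose_sum ballI)
    then show ?thesis
      by (simp add: support_conv_eq_sum[OF \<phi> \<psi> I, abs_def])
  qed
  moreover have "support (conv \<phi> \<psi>) \<subseteq> GL"
  proof
    fix g
    assume "g \<in> support (conv \<phi> \<psi>)"
    then obtain h x where "h \<in> support \<phi>" "x \<in> support \<psi>" "g = h ** x"
      by (rule support_conv[OF \<phi> \<psi> fin])
    then show "g \<in> GL"
      using \<phi> \<psi> by (auto simp: biequivariant_def intro!: GL_mult)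
  qed
  ultimately show ?thesis
    using conv_mult_left[OF assms] conv_mult_right[OF assms]
    by (simp add: biequivariant_def mem_GL fun_eq_iff)
qed

lemma conv_at_additive_pair:
  assumes ad: "additive_pair \<eta> \<delta>" and fin: "finite_cosets (dcoset \<eta>)"
    and \<phi>: "elementary \<eta> f \<phi>" and \<psi>: "elementary \<delta> g \<psi>"
  shows "conv \<phi> \<psi> (\<eta> ** \<delta>) v = f (g v)"
proof -
  note GL = additive_pair_GL[OF ad]
    and bi = elementary_biequivariant[OF \<phi>] elementary_biequivariant[OF \<psi>]
  obtain I where I: "transversal (dcoset \<eta>) I"
    using finite_cosets_transversal[OF fin] .
  obtain i where i: "i \<in> I" "\<eta> \<in> coset i"
    using I dcoset_self by (fastforce simp: transversal_def)
  then have iGL: "i \<in> GL"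
    using I dcoset_GL[OF _ GL(1)] by (auto simp: transversal_def)
  have "conv \<phi> \<psi> (\<eta> ** \<delta>) v = (\<Sum>j\<in>I. \<phi> j (\<psi> (matrix_inv j ** (\<eta> ** \<delta>)) v))"
    using dcoset_GL GL by (intro conv_eq_sum[OF bi I] elementary_support[OF \<phi>]) blast
  also have "\<dots> = (\<Sum>j\<in>{i}. \<phi> j (\<psi> (matrix_inv j ** (\<eta> ** \<delta>)) v))"
  proof (intro sum.mono_neutral_right ballI)
    fix j
    assume "j \<in> I - {i}"
    then have "coset j \<noteq> coset \<eta>" "j \<in> dcoset \<eta>"
      using I i coset_eqI[OF i(2)] by (auto simp: transversal_def dest: inj_onD)
    then have "matrix_inv j ** (\<eta> ** \<delta>) \<notin> dcoset \<delta>"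
      using additive_pair_coset_unique[OF ad] by blast
    then show "\<phi> j (\<psi> (matrix_inv j ** (\<eta> ** \<delta>)) v) = 0"
      using elementary_outside[OF \<psi>] biequivariant_zero[OF bi(1)] by simp
  qed (use I i in \<open>auto simp: transversal_def\<close>)
  also have "\<dots> = \<phi> \<eta> (\<psi> (matrix_inv \<eta> ** (\<eta> ** \<delta>)) v)"
    using conv_summand_coset[OF bi iGL i(2)] by simp
  also have "\<dots> = f (g v)"
    using GL elementary_self[OF \<phi>] elementary_self[OF \<psi>] by simp
  finally show ?thesis .
qed

lemma elementary_conv:
  assumes ad: "additive_pair \<eta> \<delta>" and fin: "finite_cosets (dcoset \<eta>)"
    and \<phi>: "elementary \<eta> f \<phi>" and \<psi>: "elementary \<delta> g \<psi>"
  shows "elementary (\<eta> ** \<delta>) (f \<circ> g) (conv \<phi> \<psi>)"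
proof -
  note bi = elementary_biequivariant[OF \<phi>] elementary_biequivariant[OF \<psi>]
  have fin': "finite_cosets (support \<phi>)"
    using fin elementary_support[OF \<phi>] by (rule finite_cosets_subset)
  have "support (conv \<phi> \<psi>) \<subseteq> dcoset (\<eta> ** \<delta>)"
    using additive_pair_dcoset_mult[OF ad] elementary_support[OF \<phi>] elementary_support[OF \<psi>]
    by (blast elim: support_conv[OF bi fin'])
  then show ?thesis
    using additive_pair_GL[OF ad] biequivariant_conv[OF bi fin']
      conv_at_additive_pair[OF ad fin \<phi> \<psi>]
    by (simp add: elementary_def fun_eq_iff)
qed

end

section \<open>Integral matrices over a local field\<close>

lemma matrix_inv_nth_cramer:
  fixes X :: "'a::field^'n^'n"
  assumes "det X \<noteq> 0"
  shows "matrix_inv X $ i $ j = det (\<chi> a b. if b = i then axis j 1 $ a else X $ a $ b) / det X"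
proof -
  have "X *v (matrix_inv X *v axis j 1) = axis j 1"
    using assms by (simp add: matrix_vector_mul_assoc GL_def invertible_det_nz)
  then have "matrix_inv X *v axis j 1 =
      (\<chi> k. det (\<chi> a b. if b = k then axis j 1 $ a else X $ a $ b) / det X)"
    by (simp add: cramer[OF assms])
  moreover have "(matrix_inv X *v axis j 1) $ i = matrix_inv X $ i $ j"
    by (simp add: matrix_vector_mult_def axis_def if_distrib[of "\<lambda>x. _ * x"] cong: if_cong)
  ultimately show ?thesis
    by simp
qed

context nonarch_local_field
begin

lemma val_one [simp]: "val 1 = 0"
  using val_mult[of 1 1] by simp

lemma val_uminus [simp]: "val (- x) = val x"
proof (cases "x = 0")
  case False
  have "val (-1) = 0"
    using val_mult[of "-1" "-1"] by simp
  then show ?thesis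
    using val_mult[of "-1" x] False by simp
qed simp

lemma val_ge_zero [simp]: "val_ge val N 0"
  by (simp add: val_ge_def)

lemma val_ge_one [simp]: "val_ge val 0 1"
  by (simp add: val_ge_def)

lemma val_ge_mono: "val_ge val N x \<Longrightarrow> M \<le> N \<Longrightarrow> val_ge val M x"
  by (auto simp: val_ge_def)

lemma val_ge_add: "val_ge val N x \<Longrightarrow> val_ge val N y \<Longrightarrow> val_ge val N (x + y)"
  using val_add[of x y] by (force simp: val_ge_def)

lemma val_ge_uminus_iff: "val_ge val N (- x) \<longleftrightarrow> val_ge val N x"
  by (simp add: val_ge_def)

lemma val_ge_mult: "val_ge val M x \<Longrightarrow> val_ge val N y \<Longrightarrow> val_ge val (M + N) (x * y)"
  using val_mult[of x y] by (cases "x = 0"; cases "y = 0") (auto simp: val_ge_def)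

lemma val_ge_sum: "(\<And>i. i \<in> S \<Longrightarrow> val_ge val N (f i)) \<Longrightarrow> val_ge val N (sum f S)"
  by (induction S rule: infinite_finite_induct) (auto intro: val_ge_add)

lemma integers_iff: "x \<in> integers val \<longleftrightarrow> val_ge val 0 x"
  by (simp add: integers_def)

lemma max_ideal_iff: "x \<in> max_ideal val \<longleftrightarrow> val_ge val 1 x"
  by (simp add: max_ideal_def)

lemma res_zero [simp]: "res 0 = 0"
  using res_kernel[of 0] by (simp add: integers_iff max_ideal_iff)

lemma res_uminus: "val_ge val 0 x \<Longrightarrow> res (- x) = - res x"
  using res_add[of x "- x"]
  by (simp add: integers_iff val_ge_uminus_iff eq_neg_iff_add_eq_0 add.commute)

lemma res_sum: "(\<And>i. i \<in> S \<Longrightarrow> val_ge val 0 (f i)) \<Longrightarrow> res (sum f S) = (\<Sum>i\<in>S. res (f i))"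
  by (induction S rule: infinite_finite_induct) (auto simp: res_add integers_iff val_ge_sum)

lemma val_ge_prod: "(\<And>i. i \<in> S \<Longrightarrow> val_ge val 0 (f i)) \<Longrightarrow> val_ge val 0 (prod f S)"
proof (induction S rule: infinite_finite_induct)
  case (insert x S)
  then show ?case
    using val_ge_mult[of 0 "f x" 0 "prod f S"] by simp
qed auto

lemma res_prod: "(\<And>i. i \<in> S \<Longrightarrow> val_ge val 0 (f i)) \<Longrightarrow> res (prod f S) = (\<Prod>i\<in>S. res (f i))"
  by (induction S rule: infinite_finite_induct)
    (auto simp: res_one res_mult integers_iff val_ge_prod)

definition mat_ge :: "int \<Rightarrow> 'f^'n^'m \<Rightarrow> bool" where
  "mat_ge N X \<longleftrightarrow> (\<forall>i j. val_ge val N (X $ i $ j))"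

definition reduce :: "'f^'n^'m \<Rightarrow> 'q^'n^'m" where
  "reduce X = (\<chi> i j. res (X $ i $ j))"

lemma mat_ge_zero [simp]: "mat_ge N 0"
  by (simp add: mat_ge_def)

lemma mat_ge_one [simp]: "mat_ge 0 (mat 1)"
  by (simp add: mat_ge_def mat_def)

lemma mat_ge_mono: "mat_ge N X \<Longrightarrow> M \<le> N \<Longrightarrow> mat_ge M X"
  by (auto simp: mat_ge_def intro: val_ge_mono)

lemma mat_ge_add: "mat_ge N X \<Longrightarrow> mat_ge N Y \<Longrightarrow> mat_ge N (X + Y)"
  by (simp add: mat_ge_def val_ge_add)

lemma mat_ge_uminus_iff [simp]: "mat_ge N (- X) \<longleftrightarrow> mat_ge N X"
  by (simp add: mat_ge_def val_ge_uminus_iff)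

lemma mat_ge_diff: "mat_ge N X \<Longrightarrow> mat_ge N Y \<Longrightarrow> mat_ge N (X - Y)"
  using mat_ge_add[of N X "- Y"] by simp

lemma mat_ge_mult: "mat_ge M X \<Longrightarrow> mat_ge N Y \<Longrightarrow> mat_ge (M + N) (X ** Y)"
  by (simp add: mat_ge_def matrix_matrix_mult_def val_ge_sum val_ge_mult)

lemma mat_ge_mult_le: "mat_ge M X \<Longrightarrow> mat_ge N Y \<Longrightarrow> L \<le> M + N \<Longrightarrow> mat_ge L (X ** Y)"
  using mat_ge_mult mat_ge_mono by blast

lemma mat_ge_zero_mult: "mat_ge 0 X \<Longrightarrow> mat_ge 0 Y \<Longrightarrow> mat_ge 0 (X ** Y)"
  using mat_ge_mult[of 0 X 0 Y] by simp

lemma reduce_zero [simp]: "reduce 0 = 0"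
  by (simp add: reduce_def vec_eq_iff)

lemma reduce_one [simp]: "reduce (mat 1) = mat 1"
  by (simp add: reduce_def vec_eq_iff mat_def res_one)

lemma reduce_add: "mat_ge 0 X \<Longrightarrow> mat_ge 0 Y \<Longrightarrow> reduce (X + Y) = reduce X + reduce Y"
  by (simp add: reduce_def vec_eq_iff mat_ge_def res_add integers_iff)

lemma reduce_uminus: "mat_ge 0 X \<Longrightarrow> reduce (- X) = - reduce X"
  by (simp add: reduce_def vec_eq_iff mat_ge_def res_uminus)

lemma reduce_diff: "mat_ge 0 X \<Longrightarrow> mat_ge 0 Y \<Longrightarrow> reduce (X - Y) = reduce X - reduce Y"
  using reduce_add[of X "- Y"] by (simp add: reduce_uminus)

lemma reduce_mult: "mat_ge 0 X \<Longrightarrow> mat_ge 0 Y \<Longrightarrow> reduce (X ** Y) = reduce X ** reduce Y"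
  using val_ge_mult[of 0 _ 0]
  by (simp add: reduce_def vec_eq_iff mat_ge_def matrix_matrix_mult_def res_mult integers_iff
      res_sum)

lemma reduce_eq_0_iff: "mat_ge 0 X \<Longrightarrow> reduce X = 0 \<longleftrightarrow> mat_ge 1 X"
  by (simp add: reduce_def vec_eq_iff mat_ge_def res_kernel integers_iff max_ideal_iff)

lemma reduce_eq_0: "mat_ge 1 X \<Longrightarrow> reduce X = 0"
  using reduce_eq_0_iff[of X] mat_ge_mono[of 1 X 0] by simp

definition lift :: "'q^'n^'m \<Rightarrow> 'f^'n^'m" where
  "lift Y = (\<chi> i j. SOME x. val_ge val 0 x \<and> res x = Y $ i $ j)"

lemma lift_nth: "val_ge val 0 (lift Y $ i $ j) \<and> res (lift Y $ i $ j) = Y $ i $ j"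
proof -
  have "\<exists>x. val_ge val 0 x \<and> res x = Y $ i $ j"
    using res_surj by (metis UNIV_I image_iff integers_iff)
  from someI_ex[OF this] show ?thesis
    by (simp add: lift_def)
qed

lemma mat_ge_lift [simp]: "mat_ge 0 (lift Y)" and reduce_lift [simp]: "reduce (lift Y) = Y"
  by (simp_all add: mat_ge_def reduce_def vec_eq_iff lift_nth)

lemma det_integral:
  assumes "mat_ge 0 (X :: 'f^'n^'n)"
  shows "val_ge val 0 (det X)" and "res (det X) = det (reduce X)"
proof -
  have sign: "val_ge val 0 (of_int (sign p) :: 'f)"
      "res (of_int (sign p)) = of_int (sign p)" for p :: "'n \<Rightarrow> 'n"
    by (simp_all add: sign_def val_ge_uminus_iff res_one res_uminus)
  have prod: "val_ge val 0 (\<Prod>i\<in>UNIV. X $ i $ p i)"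
      "res (\<Prod>i\<in>UNIV. X $ i $ p i) = (\<Prod>i\<in>UNIV. res (X $ i $ p i))" for p
    using assms by (simp_all add: val_ge_prod res_prod mat_ge_def)
  have summand: "val_ge val 0 (of_int (sign p) * (\<Prod>i\<in>UNIV. X $ i $ p i))" for p
    using val_ge_mult[OF sign(1) prod(1)] by simp
  show "val_ge val 0 (det X)"
    unfolding det_def by (intro val_ge_sum summand)
  show "res (det X) = det (reduce X)"
    unfolding det_def using summand sign prod
    by (simp add: res_sum res_mult integers_iff reduce_def)
qed

lemma integral_inverse:
  assumes X: "mat_ge 0 (X :: 'f^'n^'n)" and inv: "reduce X \<in> GL"
  shows "X \<in> GL" and "mat_ge 0 (matrix_inv X)" and "reduce (matrix_inv X) = matrix_inv (reduce X)"
proof -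
  have res_det: "res (det X) \<noteq> 0"
    using inv det_integral(2)[OF X] by (simp add: GL_def invertible_det_nz)
  then have det: "det X \<noteq> 0"
    by auto
  then show GL: "X \<in> GL"
    by (simp add: GL_def invertible_det_nz)
  have "val (det X) = 0"
    using res_det det det_integral(1)[OF X] res_kernel[of "det X"]
    by (auto simp: integers_iff max_ideal_iff val_ge_def)
  then have inv_det: "val_ge val 0 (inverse (det X))"
    using val_mult[of "det X" "inverse (det X)"] det by (simp add: val_ge_def)
  have "val_ge val 0 (matrix_inv X $ i $ j)" for i j
  proof -
    have "mat_ge 0 (\<chi> a b. if b = i then axis j 1 $ a else X $ a $ b)"
      using X by (simp add: mat_ge_def axis_def)
    from val_ge_mult[OF det_integral(1)[OF this] inv_det] show ?thesis
      by (simp add: matrix_inv_nth_cramer[OF det] divide_inverse)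
  qed
  then show integral: "mat_ge 0 (matrix_inv X)"
    by (simp add: mat_ge_def)
  have "reduce X ** reduce (matrix_inv X) = mat 1"
    using GL X integral by (simp flip: reduce_mult)
  then show "reduce (matrix_inv X) = matrix_inv (reduce X)"
    by (rule GL_right_inverse(2)[symmetric])
qed

section \<open>The parahoric subgroup and its conjugates\<close>

definition blocks_ge :: "int \<Rightarrow> ('f, 'k::finite) bmat \<Rightarrow> bool" where
  "blocks_ge n g \<longleftrightarrow> mat_ge 0 (upper_left g) \<and> mat_ge n (upper_right g) \<and>
     mat_ge (1 - n) (lower_left g) \<and> mat_ge 0 (lower_right g)"


definition parahoric_at :: "int \<Rightarrow> ('f, 'k::finite) bmat set" where
  "parahoric_at n = {g \<in> GL. blocks_ge n g \<and> blocks_ge n (matrix_inv g)}"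

lemma blocks_ge_mult: "blocks_ge n g \<Longrightarrow> blocks_ge n h \<Longrightarrow> blocks_ge n (g ** h)"
  by (auto simp: blocks_ge_def intro!: mat_ge_add elim: mat_ge_mult_le)

lemma parahoric_at_blocks_ge: "g \<in> parahoric_at n \<Longrightarrow> blocks_ge n g"
  by (simp add: parahoric_at_def)

lemma matrix_group_parahoric_at: "matrix_group (parahoric_at n)"
proof
  show "mat 1 \<in> parahoric_at n"
    by (simp add: parahoric_at_def blocks_ge_def)
qed (auto simp: parahoric_at_def blocks_ge_mult matrix_inv_mult)

lemmas parahoric_at_GL = matrix_group.mem_GL[OF matrix_group_parahoric_at]
  and parahoric_at_mult = matrix_group.mult_mem[OF matrix_group_parahoric_at]

lemma upper_unip_parahoric_at: "mat_ge n B \<Longrightarrow> upper_unip B \<in> parahoric_at n"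
  by (simp add: parahoric_at_def blocks_ge_def)

lemma lower_unip_parahoric_at_iff: "lower_unip C \<in> parahoric_at n \<longleftrightarrow> mat_ge (1 - n) C"
  by (simp add: parahoric_at_def blocks_ge_def)

lemma parahoric_at_convex:
  assumes "g \<in> parahoric_at 0" "g \<in> parahoric_at c" "min 0 c \<le> b" "b \<le> max 0 c"
  shows "g \<in> parahoric_at b"
proof -
  have "mat_ge b X" if "mat_ge 0 X" "mat_ge c X" for X :: "'f^'k^'k"
    using that assms(4) mat_ge_mono[of 0 X b] mat_ge_mono[of c X b] by linarith
  moreover have "mat_ge (1 - b) X" if "mat_ge 1 X" "mat_ge (1 - c) X" for X :: "'f^'k^'k"
    using that assms(3) mat_ge_mono[of 1 X "1 - b"] mat_ge_mono[of "1 - c" X "1 - b"] by linarith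
  ultimately show ?thesis
    using assms(1,2) by (auto simp: parahoric_at_def blocks_ge_def)
qed

lemma reduction_eq: "reduction res g = (reduce (upper_left g), reduce (lower_right g))"
  by (simp add: reduction_def reduce_def upper_left_def lower_right_def)

lemma reduction_mult:
  assumes "blocks_ge 0 g" "blocks_ge 0 h"
  shows "reduction res (g ** h) = (reduce (upper_left g) ** reduce (upper_left h),
    reduce (lower_right g) ** reduce (lower_right h))"
proof -
  have off_diagonal: "mat_ge 1 (upper_right g ** lower_left h)"
      "mat_ge 1 (lower_left g ** upper_right h)"
    using assms by (auto simp: blocks_ge_def elim: mat_ge_mult_le)
  with assms show ?thesis
    using off_diagonal[THEN mat_ge_mono, of 0]
    by (simp add: reduction_eq blocks_ge_def reduce_add reduce_mult reduce_eq_0 mat_ge_zero_mult)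
qed

lemma reduction_Levi:
  assumes "g \<in> parahoric_at 0"
  shows "reduction res g \<in> Levi"
proof -
  have "reduction res (g ** matrix_inv g) = (mat 1, mat 1)"
    using assms by (simp add: parahoric_at_GL reduction_eq)
  then have "reduce (upper_left g) ** reduce (upper_left (matrix_inv g)) = mat 1"
      "reduce (lower_right g) ** reduce (lower_right (matrix_inv g)) = mat 1"
    using assms by (simp_all add: reduction_mult parahoric_at_def del: GL_mult_inv)
  then show ?thesis
    unfolding reduction_eq Levi_def using GL_right_inverse(1) by blast
qed

lemma parahoric_at_zero_blocks:
  assumes "g \<in> parahoric_at 0"
  shows "reduce (upper_left g) \<in> GL" "reduce (lower_right g) \<in> GL"
  using reduction_Levi[OF assms] by (simp_all add: reduction_eq Levi_def)

lemma integral_iff_quadrants: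
  "(\<forall>i j. g $ i $ j \<in> integers val) \<longleftrightarrow> mat_ge 0 (upper_left g) \<and> mat_ge 0 (upper_right g) \<and>
     mat_ge 0 (lower_left g) \<and> mat_ge 0 (lower_right g)"
  for g :: "('f, 'k::finite) bmat"
proof -
  have all_sum: "(\<forall>i. Q i) \<longleftrightarrow> (\<forall>a. Q (Inl a)) \<and> (\<forall>b. Q (Inr b))" for Q :: "'k + 'k \<Rightarrow> bool"
    by (metis sum.exhaust)
  show ?thesis
    unfolding all_sum mat_ge_def by (auto simp: integers_iff quadrant_defs)
qed

lemma lower_left_matrix_inv_ge:
  fixes g :: "('f, 'k::finite) bmat"
  assumes g: "g \<in> GL" "blocks_ge 0 g"
    and inv: "mat_ge 0 (upper_left (matrix_inv g))" "mat_ge 0 (upper_right (matrix_inv g))"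
      "mat_ge 0 (lower_left (matrix_inv g))" "mat_ge 0 (lower_right (matrix_inv g))"
  shows "mat_ge 1 (lower_left (matrix_inv g))"
proof -
  define h where "h = matrix_inv g"
  have "g ** h = mat 1"
    using g by (simp add: h_def)
  then have product_blocks: "lower_left g ** upper_left h + lower_right g ** lower_left h = 0"
      "lower_left g ** upper_right h + lower_right g ** lower_right h = mat 1"
    by (simp_all add: bmat_eq_iff)
  have summands: "reduce (lower_left g ** X) = 0" "mat_ge 0 (lower_left g ** X)"
      "mat_ge 0 (lower_right g ** X)" if "mat_ge 0 X" for X :: "'f^'k^'k"
    using g(2) that mat_ge_mult[of 1 "lower_left g" 0 X]
    by (auto simp: blocks_ge_def reduce_eq_0 elim: mat_ge_mult_le)
  have "reduce (lower_right g) ** reduce (lower_right h) = mat 1"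
    using arg_cong[OF product_blocks(2), of reduce] g(2) inv summands
    by (simp add: reduce_add reduce_mult h_def blocks_ge_def)
  moreover have "reduce (lower_right g) ** reduce (lower_left h) = 0"
    using arg_cong[OF product_blocks(1), of reduce] g(2) inv summands
    by (simp add: reduce_add reduce_mult h_def blocks_ge_def)
  ultimately have "reduce (lower_left h) = 0"
    by (metis GL_inv_mult_cancel_left GL_right_inverse(1) matrix_mult_zero_right)
  then show ?thesis
    using inv(3) by (simp add: h_def reduce_eq_0_iff)
qed

lemma parahoric_eq: "parahoric val = (parahoric_at 0 :: ('f, 'k::finite) bmat set)"
proof (intro set_eqI iffI)
  fix g :: "('f, 'k) bmat"
  assume "g \<in> parahoric_at 0"
  then show "g \<in> parahoric val"
    using mat_ge_mono[of 1 "lower_left g" 0] mat_ge_mono[of 1 "lower_left (matrix_inv g)" 0]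
    unfolding parahoric_def GL_integers_def integral_iff_quadrants
    by (auto simp: parahoric_at_def blocks_ge_def max_ideal_iff mat_ge_def lower_left_def)
next
  fix g :: "('f, 'k) bmat"
  assume g: "g \<in> parahoric val"
  then have "blocks_ge 0 g"
    unfolding parahoric_def GL_integers_def integral_iff_quadrants
    by (auto simp: blocks_ge_def max_ideal_iff mat_ge_def lower_left_def)
  with g show "g \<in> parahoric_at 0"
    using lower_left_matrix_inv_ge[of g]
    unfolding parahoric_def GL_integers_def integral_iff_quadrants
    by (simp add: parahoric_at_def blocks_ge_def)
qed

lemma block_diagonal_parahoric_at:
  assumes "mat_ge 0 A" "reduce A \<in> GL" "mat_ge 0 D" "reduce D \<in> GL"
  shows "block A 0 0 D \<in> parahoric_at n"
proof -
  have inv: "block A 0 0 D ** block (matrix_inv A) 0 0 (matrix_inv D) = mat 1"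
    using integral_inverse(1)[OF assms(1,2)] integral_inverse(1)[OF assms(3,4)]
    by (simp add: mat_one_eq_block)
  show ?thesis
    using GL_right_inverse[OF inv] assms integral_inverse(2)[of A] integral_inverse(2)[of D]
    by (simp add: parahoric_at_def blocks_ge_def)
qed

lemma block_lower_triangular_parahoric_at:
  assumes g: "g \<in> parahoric_at 0" and "upper_right g = 0" "0 \<le> n"
  shows "g \<in> parahoric_at n"
proof -
  have "upper_left g \<in> GL"
    using g integral_inverse(1)[of "upper_left g"] parahoric_at_zero_blocks
    by (auto simp: parahoric_at_def blocks_ge_def)
  moreover have "upper_left g ** upper_right (matrix_inv g) = 0"
    using arg_cong[OF GL_mult_inv[OF parahoric_at_GL[OF g]], of upper_right] assms(2) by simp
  ultimately have "upper_right (matrix_inv g) = 0"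
    by (metis GL_inv_mult_cancel_left matrix_mult_zero_right)
  then show ?thesis
    using assms by (auto simp: parahoric_at_def blocks_ge_def elim: mat_ge_mono)
qed

lemma parahoric_at_zero_factor_upper_unip:
  assumes g: "g \<in> parahoric_at 0"
  obtains B q where "g = upper_unip B ** q" "mat_ge 0 B" "q \<in> parahoric_at 0" "upper_right q = 0"
proof -
  have blocks: "mat_ge 0 (upper_right g)" "mat_ge 0 (lower_right g)"
    using g by (auto simp: parahoric_at_def blocks_ge_def)
  note inv = integral_inverse[OF blocks(2) parahoric_at_zero_blocks(2)[OF g]]
  define B where "B = upper_right g ** matrix_inv (lower_right g)"
  have B: "mat_ge 0 B"
    using mat_ge_zero_mult[OF blocks(1) inv(2)] by (simp add: B_def)
  show thesis
  proof (rule that)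
    show "g = upper_unip B ** (upper_unip (- B) ** g)"
      using GL_mult_inv_cancel_left[OF GL_upper_unip, of B g] by simp
    show "upper_unip (- B) ** g \<in> parahoric_at 0"
      using B g by (intro parahoric_at_mult upper_unip_parahoric_at) auto
    show "upper_right (upper_unip (- B) ** g) = 0"
      using inv by (simp add: B_def matrix_ring_simps)
  qed (rule B)
qed

end

section \<open>The extended affine Weyl group\<close>

definition signed :: "bool \<Rightarrow> int \<Rightarrow> int" where
  "signed d n = (if d then n else - n)"

lemma signed_simps [simp]: "signed True n = n" "signed False n = - n" "signed d 0 = 0"
  by (simp_all add: signed_def)

definition twist :: "bool \<Rightarrow> ('q::field, 'k::finite) levi \<Rightarrow> ('q, 'k) levi" where
  "twist d m = (if d then m else prod.swap m)"

lemma twist_Levi [simp]: "twist d m \<in> Levi \<longleftrightarrow> m \<in> Levi"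
  by (cases m) (auto simp: twist_def Levi_def)

lemma twist_twist: "twist d (twist d' m) = twist (d = d') m"
  by (simp add: twist_def)

lemma twist_True [simp]: "twist True m = m"
  by (simp add: twist_def)

lemma twist_one [simp]: "twist d (mat 1, mat 1) = (mat 1, mat 1)"
  by (simp add: twist_def)

locale local_field_uniformizer = nonarch_local_field val res
  for val :: "'f::field \<Rightarrow> int" and res :: "'f \<Rightarrow> 'q::{field,finite}" +
  fixes \<pi> :: 'f
  assumes uniformizer: "uniformizer val \<pi>"
begin

lemma uniformizer_nonzero [simp]: "\<pi> \<noteq> 0"
  using uniformizer by (simp add: uniformizer_def)

lemma val_uniformizer_power: "val (\<pi> ^ n) = int n"
  using uniformizer by (induction n) (simp_all add: val_mult uniformizer_def)

lemma val_uniformizer_powi [simp]: "val (\<pi> powi a) = a"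
proof (cases "a \<ge> 0")
  case True
  then show ?thesis
    by (simp add: power_int_def val_uniformizer_power)
next
  case False
  have "val (\<pi> powi a) + val (\<pi> powi (- a)) = 0"
    using val_mult[of "\<pi> powi a" "\<pi> powi (- a)"] by (simp flip: power_int_add)
  moreover have "val (\<pi> powi (- a)) = - a"
    using False by (simp add: power_int_def val_uniformizer_power)
  ultimately show ?thesis
    by simp
qed

lemma mat_ge_uniformizer_powi_mult: "mat_ge n X \<Longrightarrow> mat_ge (n + c) (mat (\<pi> powi c) ** X)"
  using val_ge_mult[of c "\<pi> powi c" n]
  by (simp add: mat_ge_def mat_mult_nth add.commute) (simp add: val_ge_def)

definition weyl_elt :: "bool \<Rightarrow> int \<Rightarrow> int \<Rightarrow> ('f, 'k::finite) bmat" where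
  "weyl_elt d a b = (if d then block (mat (\<pi> powi a)) 0 0 (mat (\<pi> powi b))
                     else block 0 (mat (\<pi> powi a)) (mat (\<pi> powi b)) 0)"

text \<open>The elements that move the index of \<open>parahoric_at\<close> by \<open>n \<mapsto> m + n\<close>, if \<open>d\<close>, or by
  \<open>n \<mapsto> m - n\<close>; the flag \<open>d\<close> tells whether they are diagonal.\<close>

definition Weyl_type :: "bool \<Rightarrow> int \<Rightarrow> ('f, 'k::finite) bmat set" where
  "Weyl_type d m = {weyl_elt d a b | a b. m = (if d then a - b else 1 + a - b)}"

lemma weyl_elt_mult:
  "weyl_elt True a b ** weyl_elt d a' b' = weyl_elt d (a + a') (b + b')"
  "weyl_elt False a b ** weyl_elt d a' b' = weyl_elt (\<not> d) (a + b') (b + a')"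
  by (simp_all add: weyl_elt_def mat_mult_mat power_int_add)

lemma weyl_elt_one: "mat 1 = weyl_elt True 0 0"
  by (simp add: weyl_elt_def mat_one_eq_block)

lemma weyl_elt_mult_inverse:
  "weyl_elt d a b ** weyl_elt d (if d then - a else - b) (if d then - b else - a) = mat 1"
  by (cases d) (simp_all add: weyl_elt_mult weyl_elt_one)

lemmas GL_weyl_elt = GL_right_inverse(1)[OF weyl_elt_mult_inverse]
  and inv_weyl_elt = GL_right_inverse(2)[OF weyl_elt_mult_inverse]

lemma weyl_elt_eq_iff [simp]: "weyl_elt d a b = weyl_elt d' a' b' \<longleftrightarrow> d = d' \<and> a = a' \<and> b = b'"
proof -
  have "\<pi> powi m = \<pi> powi n \<longleftrightarrow> m = n" for m n
    using val_uniformizer_powi by metis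
  then show ?thesis
    by (auto simp: weyl_elt_def mat_eq_iff)
qed

lemma Weyl_typeE:
  assumes "\<eta> \<in> Weyl_type d m"
  obtains a b where "\<eta> = weyl_elt d a b" "m = (if d then a - b else 1 + a - b)"
  using assms by (auto simp: Weyl_type_def)

lemma weyl_elt_type: "weyl_elt d a b \<in> Weyl_type d (if d then a - b else 1 + a - b)"
  by (auto simp: Weyl_type_def)

lemma Weyl_type_GL: "\<eta> \<in> Weyl_type d m \<Longrightarrow> \<eta> \<in> GL"
  by (auto simp: Weyl_type_def GL_weyl_elt)

lemma Weyl_type_mult:
  assumes "\<eta> \<in> Weyl_type d m" "\<delta> \<in> Weyl_type d' m'"
  shows "\<eta> ** \<delta> \<in> Weyl_type (d = d') (m + signed d m')"
proof -
  obtain a b a' b' where "\<eta> = weyl_elt d a b" "m = (if d then a - b else 1 + a - b)"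
      "\<delta> = weyl_elt d' a' b'" "m' = (if d' then a' - b' else 1 + a' - b')"
    using assms by (elim Weyl_typeE)
  then show ?thesis
    by (cases d; cases d') (auto simp: weyl_elt_mult Weyl_type_def)
qed

lemma Weyl_type_inv:
  assumes "\<eta> \<in> Weyl_type d m"
  shows "matrix_inv \<eta> \<in> Weyl_type d (- signed d m)"
proof -
  obtain a b where "\<eta> = weyl_elt d a b" "m = (if d then a - b else 1 + a - b)"
    using assms by (rule Weyl_typeE)
  then show ?thesis
    by (cases d) (auto simp: inv_weyl_elt Weyl_type_def)
qed

lemma generators_eq_weyl_elt:
  "block_diag \<pi> a b = weyl_elt True a b" "w_mat = weyl_elt False 0 0" "t_mat \<pi> = weyl_elt False 0 1"
  "w'_mat \<pi> = weyl_elt False (- 1) 1"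
proof -
  show w: "w_mat = weyl_elt False 0 0" and t: "t_mat \<pi> = weyl_elt False 0 1"
      and "block_diag \<pi> a b = weyl_elt True a b"
    by (simp_all add: block_diag_def weyl_elt_def w_mat_def t_mat_def)
  show "w'_mat \<pi> = weyl_elt False (- 1) 1"
    by (simp add: w'_mat_def w t inv_weyl_elt weyl_elt_mult)
qed

lemma one_type: "mat 1 \<in> Weyl_type True 0"
  and w_mat_type: "w_mat \<in> Weyl_type False 1"
  and t_mat_type: "t_mat \<pi> \<in> Weyl_type False 0"
  and w'_mat_type: "w'_mat \<pi> \<in> Weyl_type False (- 1)"
  by (auto simp: generators_eq_weyl_elt weyl_elt_one Weyl_type_def)

lemma Weyl_type_exists: "\<eta> \<in> Weyl \<pi> \<Longrightarrow> \<exists>d m. \<eta> \<in> Weyl_type d m"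
proof (induction rule: Weyl.induct)
  case (diag a b)
  then show ?case
    using weyl_elt_type[of True a b] by (auto simp: generators_eq_weyl_elt)
qed (use w_mat_type Weyl_type_mult Weyl_type_inv in blast)+

lemma is_diagonal_Weyl_type_iff:
  assumes "(\<eta> :: ('f, 'k::finite) bmat) \<in> Weyl_type d m"
  shows "is_diagonal \<eta> \<longleftrightarrow> d"
proof -
  obtain a b where \<eta>: "\<eta> = weyl_elt d a b"
    using assms by (rule Weyl_typeE)
  show ?thesis
  proof
    assume diagonal: "is_diagonal \<eta>"
    fix i :: 'k
    have "\<eta> $ Inl i $ Inr i = 0"
      using diagonal by (simp add: is_diagonal_def)
    then show d
      by (simp add: \<eta> weyl_elt_def block_def mat_def split: if_splits)
  qed (auto simp: \<eta> is_diagonal_def weyl_elt_def block_def mat_def split: sum.splits)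
qed

lemma weyl_elt_conj:
  "weyl_elt d a b ** g ** matrix_inv (weyl_elt d a b) =
    (if d then block (upper_left g) (mat (\<pi> powi (a - b)) ** upper_right g)
                 (mat (\<pi> powi (b - a)) ** lower_left g) (lower_right g)
     else block (lower_right g) (mat (\<pi> powi (a - b)) ** lower_left g)
                 (mat (\<pi> powi (b - a)) ** upper_right g) (upper_left g))"
  (is "_ = ?c")
proof -
  have [simp]: "\<pi> powi (x - y) * z * \<pi> powi y = \<pi> powi x * z" for x y z
    by (simp add: power_int_diff)
  have "weyl_elt d a b ** g = ?c ** weyl_elt d a b"
    by (auto simp: bmat_eq_iff weyl_elt_def vec_eq_iff mat_mult_nth mult_mat_nth)
  then show ?thesis
    by (simp add: GL_weyl_elt)
qed

lemma blocks_ge_conj: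
  assumes "\<eta> \<in> Weyl_type d m" "blocks_ge n g"
  shows "blocks_ge (m + signed d n) (\<eta> ** g ** matrix_inv \<eta>)"
proof -
  obtain a b where \<eta>: "\<eta> = weyl_elt d a b" "m = (if d then a - b else 1 + a - b)"
    using assms(1) by (rule Weyl_typeE)
  show ?thesis
    using assms(2) mat_ge_uniformizer_powi_mult[of n "upper_right g" "a - b"]
      mat_ge_uniformizer_powi_mult[of "1 - n" "lower_left g" "b - a"]
      mat_ge_uniformizer_powi_mult[of n "upper_right g" "b - a"]
      mat_ge_uniformizer_powi_mult[of "1 - n" "lower_left g" "a - b"]
    by (cases d) (auto simp: blocks_ge_def \<eta> weyl_elt_conj algebra_simps)
qed

lemma parahoric_at_conj:
  assumes \<eta>: "\<eta> \<in> Weyl_type d m" and g: "g \<in> parahoric_at n"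
  shows "\<eta> ** g ** matrix_inv \<eta> \<in> parahoric_at (m + signed d n)"
  using g blocks_ge_conj[OF \<eta>, of n g] blocks_ge_conj[OF \<eta>, of n "matrix_inv g"] Weyl_type_GL[OF \<eta>]
  by (simp add: parahoric_at_def matrix_inv_mult matrix_mul_assoc)

lemma parahoric_at_inv_conj_iff:
  assumes \<eta>: "\<eta> \<in> Weyl_type d m"
  shows "matrix_inv \<eta> ** g ** \<eta> \<in> parahoric_at n \<longleftrightarrow> g \<in> parahoric_at (m + signed d n)"
proof
  assume "matrix_inv \<eta> ** g ** \<eta> \<in> parahoric_at n"
  from parahoric_at_conj[OF \<eta> this] show "g \<in> parahoric_at (m + signed d n)"
    using Weyl_type_GL[OF \<eta>] by (simp add: matrix_mul_assoc)
next
  assume "g \<in> parahoric_at (m + signed d n)"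
  from parahoric_at_conj[OF Weyl_type_inv[OF \<eta>] this] show "matrix_inv \<eta> ** g ** \<eta> \<in> parahoric_at n"
    using Weyl_type_GL[OF \<eta>] by (cases d) simp_all
qed

lemma length_zero_conj:
  "y \<in> Weyl_type d 0 \<Longrightarrow> g \<in> parahoric_at 0 \<Longrightarrow> y ** g ** matrix_inv y \<in> parahoric_at 0"
  using parahoric_at_conj[of y d 0 g 0] by simp

lemma length_zero_inv_conj:
  "y \<in> Weyl_type d 0 \<Longrightarrow> g \<in> parahoric_at 0 \<Longrightarrow> matrix_inv y ** g ** y \<in> parahoric_at 0"
  by (simp add: parahoric_at_inv_conj_iff)

lemma reduction_conj:
  assumes "\<eta> \<in> Weyl_type d m"
  shows "reduction res (\<eta> ** g ** matrix_inv \<eta>) = twist d (reduction res g)"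
proof -
  obtain a b where "\<eta> = weyl_elt d a b"
    using assms by (rule Weyl_typeE)
  then show ?thesis
    using weyl_elt_conj[of d a b g] by (simp add: reduction_eq twist_def del: quadrant_mult)
qed

lemma reduction_inv_conj:
  assumes "\<eta> \<in> Weyl_type d m"
  shows "reduction res (matrix_inv \<eta> ** g ** \<eta>) = twist d (reduction res g)"
  using reduction_conj[OF Weyl_type_inv[OF assms], of g] Weyl_type_GL[OF assms] by simp

lemma mat_powi_t_mat: "mat_powi (t_mat \<pi>) i = weyl_elt (even i) (i div 2) ((i + 1) div 2)"
proof -
  have pos: "((**) (weyl_elt False 0 1) ^^ n) (mat 1) =
      weyl_elt (even n) (int n div 2) ((int n + 1) div 2)" for n
    by (induction n) (auto simp: weyl_elt_one weyl_elt_mult)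
  have neg: "((**) (weyl_elt False (- 1) 0) ^^ n) (mat 1) =
      weyl_elt (even n) ((- int n) div 2) ((- int n + 1) div 2)" for n
    by (induction n) (auto simp: weyl_elt_one weyl_elt_mult)
  show ?thesis
  proof (cases "0 \<le> i")
    case True
    then show ?thesis
      using pos[of "nat i"] by (simp add: mat_powi_def generators_eq_weyl_elt even_nat_iff)
  next
    case False
    then show ?thesis
      using neg[of "nat (- i)"]
      by (simp add: mat_powi_def generators_eq_weyl_elt inv_weyl_elt even_nat_iff add.commute)
  qed
qed

lemma mat_powi_t_mat_type: "mat_powi (t_mat \<pi>) i \<in> Weyl_type (even i) 0"
  using weyl_elt_type[of "even i" "i div 2" "(i + 1) div 2"] unfolding mat_powi_t_mat
  by (cases "even i") (auto elim!: evenE oddE)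

lemma length_zero_eq_mat_powi:
  assumes "\<eta> \<in> Weyl_type d 0"
  obtains i where "\<eta> = mat_powi (t_mat \<pi>) i"
proof -
  obtain a b where "\<eta> = weyl_elt d a b" "0 = (if d then a - b else 1 + a - b)"
    using assms by (rule Weyl_typeE)
  then have "\<eta> = mat_powi (t_mat \<pi>) (a + b)"
    by (cases d) (auto simp: mat_powi_t_mat algebra_simps)
  with that show thesis .
qed

lemma simple_refl_type:
  assumes "v \<in> simple_refls \<pi>"
  shows "\<exists>m. v \<in> Weyl_type False m \<and> \<bar>m\<bar> = 1"
  using assms w_mat_type w'_mat_type by (force simp: simple_refls_def)

lemma simple_refl_conj_w_mat:
  assumes "v \<in> simple_refls \<pi>"
  obtains d y where "y \<in> Weyl_type d 0" "v = y ** w_mat ** matrix_inv y"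
proof -
  have "w_mat = mat 1 ** w_mat ** matrix_inv (mat 1)"
    by simp
  then show thesis
    using assms that one_type t_mat_type unfolding simple_refls_def w'_mat_def by blast
qed

lemma word_type:
  assumes "set ss \<subseteq> simple_refls \<pi>"
  shows "\<exists>d m. foldr (**) ss (mat_powi (t_mat \<pi>) i) \<in> Weyl_type d m \<and> \<bar>m\<bar> \<le> int (length ss)"
  using assms
proof (induction ss)
  case Nil
  then show ?case
    using mat_powi_t_mat_type by force
next
  case (Cons s ss)
  then obtain d m where ss: "foldr (**) ss (mat_powi (t_mat \<pi>) i) \<in> Weyl_type d m"
      "\<bar>m\<bar> \<le> int (length ss)"
    by auto
  obtain e where e: "s \<in> Weyl_type False e" "\<bar>e\<bar> = 1"
    using Cons.prems simple_refl_type[of s] by auto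
  have "foldr (**) (s # ss) (mat_powi (t_mat \<pi>) i) \<in> Weyl_type (\<not> d) (e - m)"
    using Weyl_type_mult[OF e(1) ss(1)] by simp
  moreover have "\<bar>e - m\<bar> \<le> int (length (s # ss))"
    using e(2) ss(2) by auto
  ultimately show ?case
    by blast
qed

lemma simple_refl_of_sign:
  assumes "m \<noteq> 0"
  shows "\<exists>v\<in>simple_refls \<pi>. v \<in> Weyl_type False (sgn m) \<and> v ** v = mat 1"
proof (cases "m > 0")
  case True
  then show ?thesis
    using w_mat_type by (auto simp: simple_refls_def)
next
  case False
  moreover have "w'_mat \<pi> ** w'_mat \<pi> = mat 1"
    by (simp add: generators_eq_weyl_elt weyl_elt_mult weyl_elt_one)
  ultimately show ?thesis
    using assms w'_mat_type by (auto simp: simple_refls_def)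
qed

lemma reduced_word:
  assumes "(\<eta> :: ('f, 'k::finite) bmat) \<in> Weyl_type d m"
  shows "\<exists>ss i. length ss = nat \<bar>m\<bar> \<and> set ss \<subseteq> simple_refls \<pi> \<and>
    \<eta> = foldr (**) ss (mat_powi (t_mat \<pi>) i)"
  using assms
proof (induction "nat \<bar>m\<bar>" arbitrary: \<eta> d m)
  case 0
  then obtain i where "\<eta> = mat_powi (t_mat \<pi>) i"
    using length_zero_eq_mat_powi by auto
  with 0 show ?case
    by (intro exI[of _ "[]"]) auto
next
  case (Suc r)
  then have "m \<noteq> 0"
    by auto
  then obtain v :: "('f, 'k) bmat"
    where v: "v \<in> simple_refls \<pi>" "v \<in> Weyl_type False (sgn m)" "v ** v = mat 1"
    using simple_refl_of_sign by blast
  have "r = nat \<bar>sgn m - m\<bar>"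
    using Suc.hyps(2) by (auto simp: sgn_if)
  moreover have "v ** \<eta> \<in> Weyl_type (\<not> d) (sgn m - m)"
    using Weyl_type_mult[OF v(2) Suc.prems] by simp
  ultimately obtain ss i where ss: "length ss = r" "set ss \<subseteq> simple_refls \<pi>"
      "v ** \<eta> = foldr (**) ss (mat_powi (t_mat \<pi>) i)"
    using Suc.hyps(1) by metis
  have "\<eta> = v ** (v ** \<eta>)"
    using v(3) by (simp add: matrix_mul_assoc)
  then have "\<eta> = foldr (**) (v # ss) (mat_powi (t_mat \<pi>) i)"
    using ss(3) by simp
  moreover have "length (v # ss) = nat \<bar>m\<bar>" "set (v # ss) \<subseteq> simple_refls \<pi>"
    using ss v Suc.hyps(2) by simp_all
  ultimately show ?case
    by blast
qed

lemma Weyl_type_index_unique: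
  assumes "\<eta> \<in> Weyl_type d m" "\<eta> \<in> Weyl_type d' m'"
  shows "m = m'"
  using assms by (elim Weyl_typeE) simp

lemma len_Weyl_type:
  assumes "(\<eta> :: ('f, 'k::finite) bmat) \<in> Weyl_type d m"
  shows "len \<pi> \<eta> = nat \<bar>m\<bar>"
  unfolding len_def
proof (rule Least_equality)
  fix r
  assume "\<exists>ss i. length ss = r \<and> set ss \<subseteq> simple_refls \<pi> \<and> \<eta> = foldr (**) ss (mat_powi (t_mat \<pi>) i)"
  then obtain d' m' where "\<eta> \<in> Weyl_type d' m'" "\<bar>m'\<bar> \<le> int r"
    using word_type by blast
  with assms show "nat \<bar>m\<bar> \<le> r"
    using Weyl_type_index_unique[of \<eta> d m d' m'] by simp
qed (use reduced_word[OF assms] in blast)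

lemma length_one_type:
  assumes "y \<in> Weyl_type dy 0" "z \<in> Weyl_type dz 0"
  shows "y ** w_mat ** z \<in> Weyl_type (dy \<noteq> dz) (signed dy 1)"
  using Weyl_type_mult[OF Weyl_type_mult[OF assms(1) w_mat_type] assms(2)]
  by (cases dy; cases dz) simp_all

lemma length_one_factor:
  assumes \<eta>': "\<eta>' \<in> Weyl_type e 0" and v: "v \<in> simple_refls \<pi>"
    and \<eta>\<delta>: "\<eta>' ** v ** \<delta> \<in> Weyl_type e' 0"
  obtains dy ds dz y s z where "y \<in> Weyl_type dy 0" "s \<in> Weyl_type ds 0" "z \<in> Weyl_type dz 0"
    "\<eta>' ** v = y ** w_mat ** matrix_inv s" "\<delta> = s ** w_mat ** z"
    "\<eta>' ** v ** \<delta> = y ** z" "\<eta>' ** \<delta> = y ** w_mat ** z"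
proof -
  obtain ds s where s: "s \<in> Weyl_type ds 0" "v = s ** w_mat ** matrix_inv s"
    using simple_refl_conj_w_mat[OF v] .
  define y where "y = \<eta>' ** s"
  define z where "z = matrix_inv y ** (\<eta>' ** v ** \<delta>)"
  have y: "y \<in> Weyl_type (e = ds) 0"
    using Weyl_type_mult[OF \<eta>' s(1)] by (simp add: y_def)
  have z: "z \<in> Weyl_type ((e = ds) = e') 0"
    using Weyl_type_mult[OF Weyl_type_inv[OF y] \<eta>\<delta>] by (simp add: z_def)
  note GL = Weyl_type_GL[OF \<eta>'] Weyl_type_GL[OF s(1)]
  have "z = w_mat ** matrix_inv s ** \<delta>"
    using GL by (simp add: z_def y_def s(2) matrix_inv_mult matrix_mul_assoc)
  then show thesis
    using that[OF y s(1) z] GL by (simp add: y_def s(2) matrix_mul_assoc)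
qed

section \<open>The Iwahori factorisation\<close>

lemma parahoric_at_zero_factor:
  assumes g: "g \<in> parahoric_at 0" and mn: "m \<le> 0 \<and> 0 \<le> n \<or> n \<le> 0 \<and> 0 \<le> m"
  obtains x y where "x \<in> parahoric_at 0" "x \<in> parahoric_at m" "y \<in> parahoric_at n" "g = x ** y"
proof -
  have factor: "\<exists>x y. x \<in> parahoric_at 0 \<and> x \<in> parahoric_at m \<and> y \<in> parahoric_at n \<and> g = x ** y"
    if "g \<in> parahoric_at 0" "m \<le> 0" "0 \<le> n" for g :: "('f, 'b::finite) bmat" and m n
  proof -
    obtain B q where "g = upper_unip B ** q" "mat_ge 0 B" "q \<in> parahoric_at 0" "upper_right q = 0"
      using parahoric_at_zero_factor_upper_unip[OF \<open>g \<in> parahoric_at 0\<close>] .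
    then show ?thesis
      using that mat_ge_mono[of 0 B m]
      by (intro exI[of _ "upper_unip B"] exI[of _ q])
        (simp add: block_lower_triangular_parahoric_at upper_unip_parahoric_at)
  qed
  show thesis
  proof (cases "m \<le> 0 \<and> 0 \<le> n")
    case True
    then show thesis
      using factor[OF g] that by blast
  next
    case False
    \<comment> \<open>Conjugation by \<open>t\<close> exchanges the signs of the indices.\<close>
    note t = parahoric_at_inv_conj_iff[OF t_mat_type]
    have "- m \<le> 0" "0 \<le> - n"
      using mn False by auto
    with factor[OF length_zero_conj[OF t_mat_type g]]
    obtain x y where xy: "x \<in> parahoric_at 0" "x \<in> parahoric_at (- m)" "y \<in> parahoric_at (- n)"
        "t_mat \<pi> ** g ** matrix_inv (t_mat \<pi>) = x ** y"
      by blast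
    have "g = matrix_inv (t_mat \<pi>) ** (t_mat \<pi> ** g ** matrix_inv (t_mat \<pi>)) ** t_mat \<pi>"
      by (simp add: Weyl_type_GL[OF t_mat_type] matrix_mul_assoc)
    also have "\<dots> = (matrix_inv (t_mat \<pi>) ** x ** t_mat \<pi>) ** (matrix_inv (t_mat \<pi>) ** y ** t_mat \<pi>)"
      by (simp add: xy(4) Weyl_type_GL[OF t_mat_type] matrix_mul_assoc)
    finally show thesis
      using xy by (intro that) (simp_all add: t)
  qed
qed

lemma parahoric_at_w_mat_representative:
  assumes p: "p \<in> parahoric_at 0"
  obtains B q where "q \<in> parahoric_at 0" "p ** w_mat = upper_unip (lift B) ** w_mat ** q"
proof -
  obtain A r where r: "p = upper_unip A ** r" "mat_ge 0 A" "r \<in> parahoric_at 0" "upper_right r = 0"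
    using parahoric_at_zero_factor_upper_unip[OF p] .
  define D where "D = A - lift (reduce A)"
  have "reduce D = 0"
    using r(2) by (simp add: D_def reduce_diff)
  then have "mat_ge 1 D"
    using r(2) by (simp add: D_def mat_ge_diff flip: reduce_eq_0_iff)
  then have "upper_unip D ** r \<in> parahoric_at 1"
    using block_lower_triangular_parahoric_at[OF r(3,4)]
    by (intro parahoric_at_mult upper_unip_parahoric_at) simp_all
  then have "w_mat ** (upper_unip D ** r) ** w_mat \<in> parahoric_at 0"
    using parahoric_at_conj[OF w_mat_type, of "upper_unip D ** r" 1] by simp
  moreover have "upper_unip A = upper_unip (lift (reduce A)) ** upper_unip D"
    by (simp add: D_def)
  then have "p ** w_mat =
      upper_unip (lift (reduce A)) ** w_mat ** (w_mat ** (upper_unip D ** r) ** w_mat)"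
    unfolding r(1) by (simp only: matrix_mul_assoc w_mat_cancel_right)
  ultimately show thesis
    by (rule that)
qed

lemma lower_unip_unit_factor:
  assumes C: "mat_ge 0 C" "reduce C \<in> GL" and s: "s \<in> Weyl_type ds 0" and z: "z \<in> Weyl_type dz 0"
  obtains p q where "p \<in> parahoric_at 0" "q \<in> parahoric_at 0"
    "s ** lower_unip C ** z = p ** (s ** w_mat ** z) ** q"
    "reduction res p = twist ds (- matrix_inv (reduce C), reduce C)"
    "reduction res q = (mat 1, mat 1)"
proof -
  note GL = Weyl_type_GL[OF s] Weyl_type_GL[OF z] and inv = integral_inverse[OF C]
  define u where "u = upper_unip (matrix_inv C)"
  define b where "b = block (- matrix_inv C) 0 0 C"
  have u: "u \<in> parahoric_at 0"
    unfolding u_def using inv by (intro upper_unip_parahoric_at)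
  have "b \<in> parahoric_at 0"
    unfolding b_def using inv C by (intro block_diagonal_parahoric_at) (simp_all add: reduce_uminus)
  with u have ub: "u ** b \<in> parahoric_at 0"
    by (rule parahoric_at_mult)
  show thesis
  proof (rule that)
    show "s ** (u ** b) ** matrix_inv s \<in> parahoric_at 0"
      by (rule length_zero_conj[OF s ub])
    show "matrix_inv z ** u ** z \<in> parahoric_at 0"
      by (rule length_zero_inv_conj[OF z u])
    have "s ** lower_unip C ** z = s ** (u ** b ** w_mat ** u) ** z"
      unfolding u_def b_def by (subst lower_unip_bruhat[OF inv(1)]) (rule refl)
    also have "\<dots> = s ** (u ** b) ** matrix_inv s ** (s ** w_mat ** z) ** (matrix_inv z ** u ** z)"
      using GL by (simp add: matrix_mul_assoc)
    finally show "s ** lower_unip C ** z =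
        s ** (u ** b) ** matrix_inv s ** (s ** w_mat ** z) ** (matrix_inv z ** u ** z)" .
    show "reduction res (s ** (u ** b) ** matrix_inv s) =
        twist ds (- matrix_inv (reduce C), reduce C)"
      unfolding reduction_conj[OF s] using inv by (simp add: u_def b_def reduction_eq reduce_uminus)
    show "reduction res (matrix_inv z ** u ** z) = (mat 1, mat 1)"
      unfolding reduction_inv_conj[OF z] by (simp add: u_def reduction_eq)
  qed
qed

lemma lower_unip_unit_if_factor:
  assumes C: "mat_ge 0 C" and s: "s \<in> Weyl_type ds 0" and z: "z \<in> Weyl_type dz 0"
    and pq: "p \<in> parahoric_at 0" "q \<in> parahoric_at 0"
      "s ** lower_unip C ** z = p ** (s ** w_mat ** z) ** q"
  shows "reduce C \<in> GL"
proof -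
  note GL = Weyl_type_GL[OF s] Weyl_type_GL[OF z]
  define p' where "p' = matrix_inv s ** p ** s"
  define q' where "q' = z ** q ** matrix_inv z"
  have p'q': "p' \<in> parahoric_at 0" "q' \<in> parahoric_at 0"
    unfolding p'_def q'_def using length_zero_inv_conj[OF s pq(1)] length_zero_conj[OF z pq(2)]
    by auto
  note blocks = p'q'[THEN parahoric_at_blocks_ge]
  have "lower_unip C = matrix_inv s ** (s ** lower_unip C ** z) ** matrix_inv z"
    using GL by (simp add: matrix_mul_assoc)
  also have "\<dots> = p' ** w_mat ** q'"
    unfolding pq(3) p'_def q'_def by (simp add: matrix_mul_assoc)
  finally have "C = lower_left (p' ** w_mat ** q')"
    by (metis quadrant_block(3))
  then have C_eq: "C = lower_right p' ** upper_left q' + lower_left p' ** lower_left q'"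
    by (simp add: w_mat_def)
  have ll: "mat_ge 1 (lower_left p' ** lower_left q')"
    using blocks by (auto simp: blocks_ge_def elim: mat_ge_mult_le)
  have "reduce C = reduce (lower_right p') ** reduce (upper_left q')"
    using blocks mat_ge_mono[OF ll, of 0] unfolding C_eq
    by (simp add: reduce_add reduce_mult reduce_eq_0[OF ll] blocks_ge_def mat_ge_zero_mult)
  then show ?thesis
    using parahoric_at_zero_blocks[OF p'q'(1)] parahoric_at_zero_blocks[OF p'q'(2)] by simp
qed

lemma lower_unip_conj_upper_unip_parahoric:
  assumes B: "mat_ge 0 B" and C: "mat_ge 0 C" and CBC: "reduce C ** reduce B ** reduce C = 0"
  defines "m \<equiv> lower_unip C ** upper_unip B ** lower_unip (- C)"
  shows "m \<in> parahoric_at 0"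
    and "reduction res m = (mat 1 - reduce B ** reduce C, mat 1 + reduce C ** reduce B)"
proof -
  have BC: "mat_ge 0 (B ** C)" "mat_ge 0 (C ** B)" "mat_ge 0 (C ** B ** C)"
    using B C by (simp_all add: mat_ge_zero_mult)
  have "reduce (C ** B ** C) = 0"
    using B C BC CBC by (simp add: reduce_mult)
  then have "mat_ge 1 (C ** B ** C)"
    using BC(3) by (simp add: reduce_eq_0_iff)
  then have blocks: "blocks_ge 0 (lower_unip C ** upper_unip D ** lower_unip (- C))"
    if "D = B \<or> D = - B" for D
    unfolding lower_unip_conj_upper_unip using B BC that
    by (auto simp: blocks_ge_def mat_ge_add mat_ge_diff matrix_ring_simps)
  have "m ** (lower_unip C ** upper_unip (- B) ** lower_unip (- C)) = mat 1"
    unfolding m_def by (simp add: matrix_ring_simps mat_one_eq_block)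
  from GL_right_inverse[OF this] show "m \<in> parahoric_at 0"
    using blocks by (simp add: parahoric_at_def m_def del: block_mult)
  show "reduction res m = (mat 1 - reduce B ** reduce C, mat 1 + reduce C ** reduce B)"
    unfolding m_def lower_unip_conj_upper_unip using B C BC
    by (simp add: reduction_eq reduce_diff reduce_add reduce_mult)
qed

end

section \<open>Unipotent radicals attached to singular matrices\<close>

lemma (in vector_space) span_Int_span_Diff:
  assumes B: "independent B" and "S \<subseteq> B" and x: "x \<in> span S" "x \<in> span (B - S)"
  shows "x = 0"
proof -
  have "representation B x = representation S x" "representation B x = representation (B - S) x"
    using representation_extend[OF B x(1)] representation_extend[OF B x(2)] assms(2) by auto
  then have "representation B x b = 0" for b
    by (metis Diff_iff representation_ne_zero)
  moreover have "x \<in> span B"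
    using x(1) span_mono[OF \<open>S \<subseteq> B\<close>] by blast
  ultimately show ?thesis
    using sum_nonzero_representation_eq[OF B] by force
qed

lemma basis_columns_GL:
  fixes B :: "('a::field^'k) set"
  assumes B: "vec.independent B" "vec.span B = UNIV"
  obtains X :: "'a^'k^'k" where "X \<in> GL" "bij_betw (\<lambda>j. column j X) UNIV B"
proof -
  have "card B = CARD('k)"
    using vec.dim_eq_card[of B UNIV] B by (simp add: vec_dim_card del: vec.dim_UNIV)
  then obtain e where e: "bij_betw e (UNIV :: 'k set) B"
    using finite_same_card_bij[of "UNIV :: 'k set" B] vec.finiteI_independent[OF B(1)] by auto
  define X :: "'a^'k^'k" where "X = (\<chi> i j. e j $ i)"
  have columns: "column j X = e j" for j
    by (simp add: X_def column_def vec_eq_iff)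
  then have "vec.span (columns X) = UNIV"
    using e B(2) by (simp add: columns_def bij_betw_def full_SetCompr_eq)
  then have "X \<in> GL"
    using matrix_right_invertible_span_columns GL_right_inverse(1) by blast
  with that e columns show thesis
    by simp
qed

definition coordinate_projection :: "'k set \<Rightarrow> 'a::field^'k^'k" where
  "coordinate_projection S = (\<chi> i j. if i = j \<and> j \<in> S then 1 else 0)"

lemma coordinate_projection_empty [simp]: "coordinate_projection {} = 0"
  and coordinate_projection_UNIV [simp]: "coordinate_projection UNIV = mat 1"
  by (simp_all add: coordinate_projection_def mat_def vec_eq_iff)

lemma column_coordinate_projection:
  "column j (coordinate_projection S) = (if j \<in> S then axis j 1 else 0)"
  by (simp add: column_def coordinate_projection_def axis_def vec_eq_iff)

lemma matrix_vector_mult_axis: "A *v axis j 1 = column j (A :: 'a::field^'n^'m)"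
  by (simp add: matrix_vector_mult_def axis_def column_def vec_eq_iff if_distrib[of "\<lambda>x. _ * x"]
      cong: if_cong)

lemma GL_agreeing_off_kernel:
  fixes A :: "'a::field^'k^'k"
  obtains B Z M where "vec.independent B" "vec.span B = UNIV" "\<And>x. x \<in> Z \<Longrightarrow> A *v x = 0"
    "M \<in> GL" "\<And>x. x \<in> B - Z \<Longrightarrow> A *v x = M *v x"
proof -
  obtain Z where Z: "Z \<subseteq> {x. A *v x = 0}" "vec.independent Z" "{x. A *v x = 0} \<subseteq> vec.span Z"
    by (rule vec.maximal_independent_subset)
  define B where "B = vec.extend_basis Z"
  have B: "Z \<subseteq> B" "vec.independent B" "vec.span B = UNIV"
    using vec.extend_basis_superset[OF Z(2)] vec.independent_extend_basis[OF Z(2)]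
      vec.span_extend_basis[OF Z(2)] by (auto simp: B_def)
  have "x = 0" if "x \<in> vec.span (B - Z)" "A *v x = 0" for x
    using vec.span_Int_span_Diff[OF B(2,1), of x] that Z(3) by blast
  then have inj: "inj_on ((*v) A) (vec.span (B - Z))"
    by (simp add: vec.inj_on_iff_eq_0)
  have "vec.independent (B - Z)"
    using B(2) by (rule vec.independent_mono) blast
  moreover from this inj have "vec.independent ((*v) A ` (B - Z))"
    by (rule vec.independent_injective_image)
  moreover have "inj_on ((*v) A) (B - Z)"
    using inj vec.span_superset by (rule inj_on_subset)
  ultimately obtain h where h: "Vector_Spaces.linear (*s) (*s) h" "inj h" "\<forall>x\<in>B - Z. h x = A *v x"
    using vec.linear_independent_extend_inj by blast
  have M: "matrix h *v x = h x" for x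
    using h(1) by (simp add: matrix_works)
  then have "matrix h \<in> GL"
    using h(2)
    by (auto simp: GL_def invertible_left_inverse matrix_left_invertible_injective inj_def)
  with B(2,3) Z(1) M h(3) show thesis
    by (intro that[of B Z "matrix h"]) auto
qed

lemma rank_normal_form:
  fixes A :: "'a::field^'k^'k"
  obtains X Y S where "X \<in> GL" "Y \<in> GL" "Y ** A ** X = coordinate_projection S"
proof -
  obtain B Z M where B: "vec.independent B" "vec.span B = UNIV" and Z: "\<And>x. x \<in> Z \<Longrightarrow> A *v x = 0"
    and M: "M \<in> GL" "\<And>x. x \<in> B - Z \<Longrightarrow> A *v x = M *v x"
    using GL_agreeing_off_kernel[of A] by metis
  obtain X :: "'a^'k^'k" where X: "X \<in> GL" "bij_betw (\<lambda>j. column j X) UNIV B"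
    using basis_columns_GL[OF B] .
  define S where "S = {j. column j X \<notin> Z}"
  have "A ** X = M ** X ** coordinate_projection S"
  proof (rule matrix_eq_columnsI)
    fix j
    have "column j X \<in> B"
      using X(2) by (auto simp: bij_betw_def)
    then show "column j (A ** X) = column j (M ** X ** coordinate_projection S)"
      using Z M(2)
      by (simp add: S_def column_matrix_mult column_coordinate_projection matrix_vector_mult_axis)
  qed
  then have "matrix_inv X ** matrix_inv M ** A ** X = coordinate_projection S"
    using X(1) M(1) by (simp flip: matrix_mul_assoc)
  with that X(1) M(1) show thesis
    by (metis GL_inv GL_mult)
qed

lemma unipotent_radical_projection:
  assumes u: "u \<in> unipotent_radical (\<lambda>j. if j \<in> S then 1 else 0) X" and X: "X \<in> GL"
  obtains N where "u = mat 1 + X ** N ** matrix_inv X" "N ** coordinate_projection S = N"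
    "coordinate_projection S ** N = 0"
proof -
  obtain v where v: "u = X ** v ** matrix_inv X"
      "\<And>i j. i \<in> S \<or> j \<notin> S \<Longrightarrow> v $ i $ j = mat 1 $ i $ j"
    using u unfolding unipotent_radical_def by fastforce
  define N where "N = v - mat 1"
  have N: "N $ i $ j = 0" if "i \<in> S \<or> j \<notin> S" for i j
    using v(2)[OF that] by (simp add: N_def)
  show thesis
  proof (rule that)
    show "u = mat 1 + X ** N ** matrix_inv X"
      using X by (simp add: N_def v(1) matrix_ring_simps)
    show "N ** coordinate_projection S = N"
    proof (rule matrix_eq_columnsI)
      show "column j (N ** coordinate_projection S) = column j N" for j
        using N[of _ j]
        by (auto simp: column_matrix_mult column_coordinate_projection matrix_vector_mult_axis)
          (simp add: column_def vec_eq_iff)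
    qed
    show "coordinate_projection S ** N = 0"
      by (auto simp: matrix_matrix_mult_def vec_eq_iff coordinate_projection_def N
          intro!: sum.neutral)
  qed
qed

lemma singular_matrix_radical:
  fixes A :: "'a::field^'k^'k"
  assumes A0: "A \<noteq> 0" and sing: "A \<notin> GL"
  obtains c X where "X \<in> GL" "\<not> c constant_on UNIV"
    "\<And>u. u \<in> unipotent_radical c X \<Longrightarrow> \<exists>b. A ** b = 0 \<and> u = mat 1 - b ** A"
proof -
  obtain X Y S where XY: "X \<in> GL" "Y \<in> GL" and nf: "Y ** A ** X = coordinate_projection S"
    by (rule rank_normal_form)
  have A_eq: "A = matrix_inv Y ** coordinate_projection S ** matrix_inv X"
    using XY by (simp add: matrix_mul_assoc flip: nf)
  have "S \<noteq> {}" "S \<noteq> UNIV"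
    using A0 sing XY by (auto simp: A_eq)
  then have "\<not> (\<lambda>j. if j \<in> S then 1 else 0 :: nat) constant_on UNIV"
    by (auto simp: constant_on_def split: if_splits)
  moreover have "\<exists>b. A ** b = 0 \<and> u = mat 1 - b ** A"
    if u: "u \<in> unipotent_radical (\<lambda>j. if j \<in> S then 1 else 0) X" for u
  proof -
    obtain N where N: "u = mat 1 + X ** N ** matrix_inv X" "N ** coordinate_projection S = N"
        "coordinate_projection S ** N = 0"
      using unipotent_radical_projection[OF u XY(1)] .
    define b where "b = - (X ** N ** Y)"
    have "A ** b = - (matrix_inv Y ** (coordinate_projection S ** N) ** Y)"
      using XY by (simp add: b_def A_eq matrix_ring_simps)
    moreover have "b ** A = - (X ** (N ** coordinate_projection S) ** matrix_inv X)"
      using XY by (simp add: b_def A_eq matrix_ring_simps)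
    ultimately have "A ** b = 0 \<and> u = mat 1 - b ** A"
      by (simp add: N)
    then show ?thesis ..
  qed
  ultimately show thesis
    using that XY(1) by blast
qed

lemma unipotent_radical_constant:
  assumes "X \<in> GL" "u \<in> unipotent_radical (\<lambda>_. a) X"
  shows "u = mat 1"
proof -
  obtain v where "u = X ** v ** matrix_inv X" "\<And>i j. v $ i $ j = mat 1 $ i $ j"
    using assms(2) by (auto simp: unipotent_radical_def)
  moreover from this(2) have "v = mat 1"
    by (simp add: vec_eq_iff)
  ultimately show ?thesis
    using assms(1) by simp
qed

section \<open>The Hecke algebra of the parahoric subgroup\<close>

locale parahoric_representation = local_field_uniformizer val res \<pi>
  for val :: "'f::field \<Rightarrow> int" and res :: "'f \<Rightarrow> 'q::{field,finite}" and \<pi> :: 'f +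
  fixes smul :: "'r::field \<Rightarrow> 'v::ab_group_add \<Rightarrow> 'v"
    and \<sigma> :: "('q, 'k::finite) levi \<Rightarrow> 'v \<Rightarrow> 'v"
  assumes vector_space: "vector_space smul"
    and representation: "representation smul \<sigma>"
begin

abbreviation P :: "('f, 'k) bmat set" where
  "P \<equiv> parahoric_at 0"

lemma sigma_linear: "m \<in> Levi \<Longrightarrow> Vector_Spaces.linear smul smul (\<sigma> m)"
  using representation by (auto simp: representation_def)

lemma sigma_one [simp]: "\<sigma> (mat 1, mat 1) = id"
  using representation by (auto simp: representation_def)

lemma sigma_mult: "(a, b) \<in> Levi \<Longrightarrow> (c, d) \<in> Levi \<Longrightarrow> \<sigma> (a ** c, b ** d) = \<sigma> (a, b) \<circ> \<sigma> (c, d)"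
  using representation by (fastforce simp: representation_def)

sublocale hecke_pair P smul "\<lambda>p. \<sigma> (reduction res p)"
proof (intro hecke_pair.intro hecke_pair_axioms.intro)
  fix p q :: "('f, 'k) bmat"
  assume pq: "p \<in> P" "q \<in> P"
  show "Vector_Spaces.linear smul smul (\<sigma> (reduction res p))"
    using pq by (simp add: sigma_linear reduction_Levi)
  have "reduction res (p ** q) = (reduce (upper_left p) ** reduce (upper_left q),
      reduce (lower_right p) ** reduce (lower_right q))"
    using pq by (intro reduction_mult parahoric_at_blocks_ge)
  then show "\<sigma> (reduction res (p ** q)) = \<sigma> (reduction res p) \<circ> \<sigma> (reduction res q)"
    using reduction_Levi[OF pq(1)] reduction_Levi[OF pq(2)]
    by (simp add: reduction_eq sigma_mult del: quadrant_mult)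
qed (simp_all add: matrix_group_parahoric_at vector_space reduction_eq)

lemma double_coset_eq: "double_coset val g = dcoset g"
  by (simp add: double_coset_def dcoset_def parahoric_eq)

lemma convolution_eq: "convolution val = conv"
proof -
  have "{C \<in> left_cosets val. \<exists>h\<in>C. \<phi> h \<noteq> (\<lambda>_. 0)} =
      {coset h | h. h \<in> GL \<and> coset h \<inter> support \<phi> \<noteq> {}}" for \<phi> :: "('f, 'k) bmat \<Rightarrow> 'v \<Rightarrow> 'v"
    by (auto simp: left_cosets_def coset_def support_def parahoric_eq)
  then show ?thesis
    by (simp add: convolution_def[abs_def] conv_def[abs_def])
qed

lemma hecke_algebra_iff:
  "\<phi> \<in> hecke_algebra smul val res \<sigma> \<longleftrightarrow> biequivariant \<phi> \<and> finite (dcoset ` support \<phi>)"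
proof -
  have "{double_coset val g | g. \<phi> g \<noteq> (\<lambda>_. 0)} = dcoset ` support \<phi>"
    by (auto simp: double_coset_eq support_def)
  then show ?thesis
    by (auto simp: hecke_algebra_def biequivariant_def support_def parahoric_eq)
qed

lemma hecke_elt_eq:
  assumes \<phi>: "elementary \<eta> f \<phi>"
  shows "hecke_elt smul val res \<sigma> \<eta> f = \<phi>"
  unfolding hecke_elt_def double_coset_eq
proof (rule the_equality)
  have "dcoset ` support \<phi> \<subseteq> {dcoset \<eta>}"
    using elementary_support[OF \<phi>] dcoset_eq by blast
  then have "finite (dcoset ` support \<phi>)"
    by (rule finite_subset) simp
  then show "\<phi> \<in> hecke_algebra smul val res \<sigma> \<and> (\<forall>g. g \<notin> dcoset \<eta> \<longrightarrow> \<phi> g = (\<lambda>_. 0)) \<and> \<phi> \<eta> = f"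
    using \<phi>
    by (simp add: hecke_algebra_iff elementary_biequivariant elementary_outside elementary_self)
next
  fix \<psi>
  assume "\<psi> \<in> hecke_algebra smul val res \<sigma> \<and> (\<forall>g. g \<notin> dcoset \<eta> \<longrightarrow> \<psi> g = (\<lambda>_. 0)) \<and> \<psi> \<eta> = f"
  then have "elementary \<eta> f \<psi>"
    using elementary_GL[OF \<phi>] by (auto simp: elementary_def hecke_algebra_iff support_def)
  then show "\<psi> = \<phi>"
    using \<phi> by (rule elementary_unique)
qed

abbreviation elt :: "('f, 'k) bmat \<Rightarrow> ('v \<Rightarrow> 'v) \<Rightarrow> ('f, 'k) bmat \<Rightarrow> 'v \<Rightarrow> 'v" where
  "elt \<equiv> hecke_elt smul val res \<sigma>"

definition intertwines :: "bool \<Rightarrow> ('v \<Rightarrow> 'v) \<Rightarrow> bool" where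
  "intertwines d f \<longleftrightarrow> linear f \<and> (\<forall>m\<in>Levi. f \<circ> \<sigma> m = \<sigma> (twist d m) \<circ> f)"

lemma intertwinesD: "intertwines d f \<Longrightarrow> m \<in> Levi \<Longrightarrow> f \<circ> \<sigma> m = \<sigma> (twist d m) \<circ> f"
  by (simp add: intertwines_def)

lemma coeff_space_intertwines:
  assumes \<eta>: "\<eta> \<in> Weyl_type d m" and f: "f \<in> coeff_space smul \<sigma> \<eta>"
  shows "intertwines d f"
proof -
  have "linear f" and f_sigma: "\<And>m. m \<in> Levi \<Longrightarrow> f \<circ> \<sigma> (twist d m) = \<sigma> m \<circ> f"
    using f by (auto simp: coeff_space_def is_diagonal_Weyl_type_iff[OF \<eta>] intertwiners_def
        w_twist_def twist_def split: if_splits)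
  moreover have "f \<circ> \<sigma> m = \<sigma> (twist d m) \<circ> f" if "m \<in> Levi" for m
    using that f_sigma[of "twist d m"] by (simp add: twist_twist)
  ultimately show ?thesis
    by (simp add: intertwines_def)
qed

lemma intertwines_compose:
  assumes f: "intertwines d f" and g: "intertwines d' g"
  shows "intertwines (d = d') (f \<circ> g)"
  unfolding intertwines_def
proof (intro conjI ballI)
  fix m :: "('q, 'k) levi"
  assume m: "m \<in> Levi"
  have "(f \<circ> g) \<circ> \<sigma> m = f \<circ> (g \<circ> \<sigma> m)"
    by (rule comp_assoc)
  also have "\<dots> = (f \<circ> \<sigma> (twist d' m)) \<circ> g"
    using intertwinesD[OF g m] by (simp add: comp_assoc)
  also have "\<dots> = \<sigma> (twist d (twist d' m)) \<circ> (f \<circ> g)"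
    using intertwinesD[OF f, of "twist d' m"] m by (simp add: comp_assoc)
  finally show "(f \<circ> g) \<circ> \<sigma> m = \<sigma> (twist (d = d') m) \<circ> (f \<circ> g)"
    by (simp only: twist_twist)
qed (use f g in \<open>auto simp: intertwines_def intro: Vector_Spaces.linear_compose\<close>)

lemma elementary_hecke_elt:
  assumes \<eta>: "\<eta> \<in> Weyl_type d m" and f: "intertwines d f"
  shows "elementary \<eta> f (elt \<eta> f)"
proof -
  have "f \<circ> \<sigma> (reduction res x) = \<sigma> (reduction res (\<eta> ** x ** matrix_inv \<eta>)) \<circ> f" if "x \<in> P" for x
    unfolding reduction_conj[OF \<eta>] by (rule intertwinesD[OF f reduction_Levi[OF that]])
  then obtain \<phi> where "elementary \<eta> f \<phi>"
    using elementary_exists[OF Weyl_type_GL[OF \<eta>], of f] f by (auto simp: intertwines_def)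
  then show ?thesis
    by (simp add: hecke_elt_eq)
qed

definition representative :: "('f, 'k) bmat \<Rightarrow> ('f, 'k) bmat \<Rightarrow> 'q^'k^'k \<Rightarrow> ('f, 'k) bmat" where
  "representative y s B = y ** upper_unip (lift B) ** w_mat ** matrix_inv s"

lemma representative_eq_conj:
  "y \<in> GL \<Longrightarrow> representative y s B =
    (y ** upper_unip (lift B) ** matrix_inv y) ** (y ** w_mat ** matrix_inv s)"
  by (simp add: representative_def matrix_mul_assoc)

lemma matrix_inv_representative:
  "y \<in> GL \<Longrightarrow> s \<in> GL \<Longrightarrow>
    matrix_inv (representative y s B) = s ** w_mat ** upper_unip (- lift B) ** matrix_inv y"
  by (simp add: representative_def matrix_inv_mult matrix_mul_assoc)

lemma representative_dcoset:
  assumes y: "y \<in> Weyl_type dy 0"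
  shows "representative y s B \<in> dcoset (y ** w_mat ** matrix_inv s)"
  unfolding representative_eq_conj[OF Weyl_type_GL[OF y]]
  by (intro dcoset_mult_left dcoset_self length_zero_conj[OF y] upper_unip_parahoric_at mat_ge_lift)

lemma dcoset_cover_representative:
  assumes y: "y \<in> Weyl_type dy 0" and s: "s \<in> Weyl_type ds 0"
    and x: "x \<in> dcoset (y ** w_mat ** matrix_inv s)"
  shows "\<exists>B. x \<in> coset (representative y s B)"
proof -
  note GL = Weyl_type_GL[OF y] Weyl_type_GL[OF s]
  obtain p q where pq: "p \<in> P" "q \<in> P" "x = p ** (y ** w_mat ** matrix_inv s) ** q"
    using x by (rule dcosetE)
  obtain B r where B: "r \<in> P"
      "(matrix_inv y ** p ** y) ** w_mat = upper_unip (lift B) ** w_mat ** r"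
    using parahoric_at_w_mat_representative[OF length_zero_inv_conj[OF y pq(1)]] .
  have "x = y ** ((matrix_inv y ** p ** y) ** w_mat) ** matrix_inv s ** q"
    using GL by (simp add: pq(3) matrix_mul_assoc)
  also have "\<dots> = representative y s B ** (s ** r ** matrix_inv s ** q)"
    unfolding B(2) using GL by (simp add: representative_def matrix_mul_assoc)
  finally show ?thesis
    unfolding coset_def using mult_mem[OF length_zero_conj[OF s B(1)] pq(2)] by blast
qed

lemma inj_coset_representative:
  assumes y: "y \<in> Weyl_type dy 0" and s: "s \<in> Weyl_type ds 0"
  shows "inj (\<lambda>B. coset (representative y s B))"
proof (rule injI)
  fix B B'
  assume same: "coset (representative y s B) = coset (representative y s B')"
  note GL = Weyl_type_GL[OF y] Weyl_type_GL[OF s]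
  have "representative y s B' \<in> GL"
    using GL by (simp add: representative_def)
  from coset_eqD[OF this same]
  have "matrix_inv (representative y s B') ** representative y s B \<in> P" .
  moreover have "matrix_inv (representative y s B') ** representative y s B =
      s ** (w_mat ** (upper_unip (- lift B') ** upper_unip (lift B)) ** w_mat) ** matrix_inv s"
    using GL unfolding matrix_inv_representative[OF GL]
    by (simp add: representative_def matrix_mul_assoc del: block_mult)
  ultimately have "s ** (w_mat ** upper_unip (lift B - lift B') ** w_mat) ** matrix_inv s \<in> P"
    by simp
  from length_zero_inv_conj[OF s this] have "lower_unip (lift B - lift B') \<in> P"
    using GL by (simp add: w_mat_conj_upper_unip matrix_mul_assoc)
  then have "reduce (lift B - lift B') = 0"
    by (intro reduce_eq_0) (simp add: lower_unip_parahoric_at_iff)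
  then show "B = B'"
    by (simp add: reduce_diff)
qed

lemma transversal_representative:
  assumes y: "y \<in> Weyl_type dy 0" and s: "s \<in> Weyl_type ds 0"
  shows "transversal (dcoset (y ** w_mat ** matrix_inv s)) (range (representative y s))"
  using representative_dcoset[OF y] dcoset_cover_representative[OF y s]
    inj_on_imageI[of coset "representative y s" UNIV] inj_coset_representative[OF y s]
  by (auto simp: transversal_def o_def)

lemma finite_cosets_Weyl_type:
  assumes "\<eta> \<in> Weyl_type d m"
  shows "finite_cosets (dcoset \<eta>)"
proof -
  obtain ss :: "('f, 'k) bmat list" and i where
    ss: "set ss \<subseteq> simple_refls \<pi>" "\<eta> = foldr (**) ss (mat_powi (t_mat \<pi>) i)"
    using reduced_word[OF assms] by blast
  have refl: "finite_cosets (dcoset v)" if "v \<in> simple_refls \<pi>" for v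
    using that
    by (metis simple_refl_conj_w_mat transversal_representative transversal_finite_cosets)
  have power: "finite_cosets (dcoset (mat_powi (t_mat \<pi>) i))"
    using mat_powi_t_mat_type length_zero_inv_conj
    by (intro finite_cosets_dcoset_normalizer Weyl_type_GL) blast+
  show ?thesis
    unfolding ss(2) using ss(1)
    by (induction ss) (simp_all add: power refl finite_cosets_dcoset_mult)
qed

lemma additive_pair_Weyl_type:
  assumes \<eta>: "\<eta> \<in> Weyl_type d m" and \<delta>: "\<delta> \<in> Weyl_type d' m'"
    and add: "\<bar>m + signed d m'\<bar> = \<bar>m\<bar> + \<bar>m'\<bar>"
  shows "additive_pair \<eta> \<delta>"
  unfolding additive_pair_def
proof (intro conjI ballI impI)
  show "\<eta> \<in> GL" "\<delta> \<in> GL"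
    using \<eta> \<delta> by (simp_all add: Weyl_type_GL)
  fix q
  assume "q \<in> P"
  moreover have "- signed d m \<le> 0 \<and> 0 \<le> m' \<or> m' \<le> 0 \<and> 0 \<le> - signed d m"
    using add by (cases d) (auto simp: abs_if split: if_splits)
  ultimately obtain x y where xy: "x \<in> P" "x \<in> parahoric_at (- signed d m)" "y \<in> parahoric_at m'"
      "q = x ** y"
    by (rule parahoric_at_zero_factor)
  have "\<eta> ** x ** matrix_inv \<eta> \<in> P"
    using parahoric_at_conj[OF \<eta> xy(2)] by (cases d) simp_all
  moreover have "matrix_inv \<delta> ** y ** \<delta> \<in> P"
    using xy(3) by (simp add: parahoric_at_inv_conj_iff[OF \<delta>])
  ultimately show "\<exists>x\<in>P. \<exists>y. q = x ** y \<and> \<eta> ** x ** matrix_inv \<eta> \<in> P \<and> matrix_inv \<delta> ** y ** \<delta> \<in> P"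
    using xy by blast
next
  fix p
  assume p: "p \<in> P" "matrix_inv (\<eta> ** \<delta>) ** p ** (\<eta> ** \<delta>) \<in> P"
  from p(2) have "p \<in> parahoric_at (m + signed d m')"
    by (simp add: parahoric_at_inv_conj_iff[OF Weyl_type_mult[OF \<eta> \<delta>]])
  moreover have "\<bar>signed d m'\<bar> = \<bar>m'\<bar>"
    by (cases d) simp_all
  then have "min 0 (m + signed d m') \<le> m" "m \<le> max 0 (m + signed d m')"
    using add by linarith+
  ultimately have "p \<in> parahoric_at m"
    using p(1) parahoric_at_convex by blast
  then show "matrix_inv \<eta> ** p ** \<eta> \<in> P"
    by (simp add: parahoric_at_inv_conj_iff[OF \<eta>])
qed

lemma convolution_additive:
  assumes "\<eta> \<in> Weyl \<pi>" "\<delta> \<in> Weyl \<pi>" and f: "f \<in> coeff_space smul \<sigma> \<eta>"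
    and g: "g \<in> coeff_space smul \<sigma> \<delta>"
    and len: "len \<pi> (\<eta> ** \<delta>) = len \<pi> \<eta> + len \<pi> \<delta>"
  shows "convolution val (elt \<eta> f) (elt \<delta> g) = elt (\<eta> ** \<delta>) (f \<circ> g)"
proof -
  obtain d m d' m' where \<eta>: "\<eta> \<in> Weyl_type d m" and \<delta>: "\<delta> \<in> Weyl_type d' m'"
    using assms(1,2) Weyl_type_exists by blast
  have "\<bar>m + signed d m'\<bar> = \<bar>m\<bar> + \<bar>m'\<bar>"
    using len
    unfolding len_Weyl_type[OF \<eta>] len_Weyl_type[OF \<delta>] len_Weyl_type[OF Weyl_type_mult[OF \<eta> \<delta>]]
    by linarith
  from elementary_conv[OF additive_pair_Weyl_type[OF \<eta> \<delta> this] finite_cosets_Weyl_type[OF \<eta>]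
      elementary_hecke_elt[OF \<eta> coeff_space_intertwines[OF \<eta> f]]
      elementary_hecke_elt[OF \<delta> coeff_space_intertwines[OF \<delta> g]]]
  show ?thesis
    by (simp add: convolution_eq hecke_elt_eq)
qed

section \<open>Products of two elements of length one\<close>

lemma uminus_inv_Levi: "h \<in> GL \<Longrightarrow> (h, - matrix_inv h) \<in> Levi"
  by (simp add: Levi_def)

lemma T_star_eq_twist_sum: "T_star \<sigma> v = (\<Sum>B\<in>GL. \<sigma> (twist d (matrix_inv B, - B)) v)"
proof (cases d)
  case True
  have "T_star \<sigma> v = (\<Sum>B\<in>GL. \<sigma> (matrix_inv B, - B) v)"
    unfolding T_star_def by (rule sum.reindex_bij_witness[of _ matrix_inv matrix_inv]) auto
  with True show ?thesis
    by simp
next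
  case False
  have "T_star \<sigma> v = (\<Sum>B\<in>GL. \<sigma> (- B, matrix_inv B) v)"
    unfolding T_star_def
    by (rule sum.reindex_bij_witness[of _ uminus uminus]) (auto simp: matrix_inv_uminus)
  with False show ?thesis
    by (simp add: twist_def)
qed

lemma T_star_summand_conj:
  assumes "a \<in> GL" "b \<in> GL" "h \<in> GL"
  shows "\<sigma> (h, - matrix_inv h) (\<sigma> (a, b) v) =
    \<sigma> (b, a) (\<sigma> (matrix_inv b ** h ** a, - matrix_inv (matrix_inv b ** h ** a)) v)"
proof -
  have "\<sigma> (b, a) (\<sigma> (matrix_inv b ** h ** a, - matrix_inv (matrix_inv b ** h ** a)) v) =
      \<sigma> (b ** (matrix_inv b ** h ** a), a ** - matrix_inv (matrix_inv b ** h ** a)) v"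
    using assms uminus_inv_Levi[of "matrix_inv b ** h ** a"]
    by (subst sigma_mult) (simp_all add: Levi_def)
  also have "b ** (matrix_inv b ** h ** a) = h ** a"
    using assms by (simp add: matrix_mul_assoc)
  also have "a ** - matrix_inv (matrix_inv b ** h ** a) = - matrix_inv h ** b"
    using assms by (simp add: matrix_inv_mult matrix_ring_simps)
  also have "\<sigma> (h ** a, - matrix_inv h ** b) v = \<sigma> (h, - matrix_inv h) (\<sigma> (a, b) v)"
    using assms uminus_inv_Levi[of h] by (subst sigma_mult) (simp_all add: Levi_def)
  finally show ?thesis ..
qed

lemma intertwines_T_star: "intertwines False (T_star \<sigma>)"
  unfolding intertwines_def
proof (intro conjI ballI)
  have "linear (\<lambda>v. \<Sum>h\<in>GL. \<sigma> (h, - matrix_inv h) v)"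
    by (intro V.linear_compose_sum ballI sigma_linear uminus_inv_Levi)
  then show "linear (T_star \<sigma>)"
    by (simp add: T_star_def[abs_def])
next
  fix m :: "('q, 'k) levi"
  assume "m \<in> Levi"
  then obtain a b where ab: "m = (a, b)" "a \<in> GL" "b \<in> GL"
    by (auto simp: Levi_def)
  have "T_star \<sigma> (\<sigma> (a, b) v) = \<sigma> (b, a) (T_star \<sigma> v)" for v
  proof -
    have "T_star \<sigma> (\<sigma> (a, b) v) = (\<Sum>h\<in>GL. \<sigma> (b, a) (\<sigma> (h, - matrix_inv h) v))"
      unfolding T_star_def
      by (rule sum.reindex_bij_witness[of _ "\<lambda>h. b ** h ** matrix_inv a"
            "\<lambda>h. matrix_inv b ** h ** a"])
        (use ab in \<open>simp_all add: T_star_summand_conj matrix_mul_assoc\<close>)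
    also have "\<dots> = \<sigma> (b, a) (T_star \<sigma> v)"
      unfolding T_star_def using ab
      by (intro V.linear_sum[symmetric] sigma_linear) (simp add: Levi_def)
    finally show ?thesis .
  qed
  then show "T_star \<sigma> \<circ> \<sigma> m = \<sigma> (twist False m) \<circ> T_star \<sigma>"
    by (simp add: ab twist_def fun_eq_iff)
qed

lemma unipotent_fixes_value:
  assumes \<Theta>: "biequivariant \<Theta>" and C: "mat_ge 0 C" and b: "reduce C ** b = 0"
    and y: "y \<in> Weyl_type dy 0" and z: "z \<in> Weyl_type dz 0"
  shows "\<sigma> (twist dy (mat 1 - b ** reduce C, mat 1)) (\<Theta> (y ** lower_unip C ** z) v) =
    \<Theta> (y ** lower_unip C ** z) v"
proof -
  note GL = Weyl_type_GL[OF y] Weyl_type_GL[OF z]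
  define x where "x = y ** lower_unip C ** z"
  define u where "u = upper_unip (lift b)"
  define m where "m = lower_unip C ** u ** lower_unip (- C)"
  have x: "x \<in> GL"
    unfolding x_def using GL by (intro GL_mult GL_lower_unip)
  have u: "u \<in> P"
    unfolding u_def by (intro upper_unip_parahoric_at mat_ge_lift)
  have m: "m \<in> P" "reduction res m = (mat 1 - b ** reduce C, mat 1)"
    using lower_unip_conj_upper_unip_parahoric[of "lift b" C] C b
    by (simp_all add: m_def u_def del: block_mult)
  have "lower_unip (- C) ** lower_unip C = mat 1"
    by (simp add: mat_one_eq_block)
  then have "m ** lower_unip C = lower_unip C ** u"
    unfolding m_def by (metis matrix_mul_assoc matrix_mul_rid)
  then have "y ** (m ** lower_unip C) ** z = y ** (lower_unip C ** u) ** z"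
    by simp
  then have "(y ** m ** matrix_inv y) ** x = x ** (matrix_inv z ** u ** z)"
    unfolding x_def using GL by (simp add: matrix_mul_assoc del: block_mult)
  then have "\<sigma> (reduction res (y ** m ** matrix_inv y)) \<circ> \<Theta> x =
      \<Theta> x \<circ> \<sigma> (reduction res (matrix_inv z ** u ** z))"
    using biequivariant_left[OF \<Theta> x length_zero_conj[OF y m(1)]]
      biequivariant_right[OF \<Theta> x length_zero_inv_conj[OF z u]] by simp
  moreover have "reduction res u = (mat 1, mat 1)"
    by (simp add: u_def reduction_eq)
  ultimately show ?thesis
    by (simp add: reduction_conj[OF y] reduction_inv_conj[OF z] m(2) x_def fun_eq_iff)
qed

lemma cuspidal_vanishing:
  assumes cusp: "cuspidal \<sigma>" and \<Theta>: "biequivariant \<Theta>"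
    and C: "mat_ge 0 C" "reduce C \<noteq> 0" "reduce C \<notin> GL"
    and y: "y \<in> Weyl_type dy 0" and z: "z \<in> Weyl_type dz 0"
  shows "\<Theta> (y ** lower_unip C ** z) = (\<lambda>_. 0)"
proof
  fix v
  obtain c X where X: "X \<in> GL" "\<not> c constant_on UNIV"
    and radical: "\<And>u. u \<in> unipotent_radical c X \<Longrightarrow> \<exists>b. reduce C ** b = 0 \<and> u = mat 1 - b ** reduce C"
    using singular_matrix_radical[OF C(2,3)] by metis
  have fixed: "\<sigma> (twist dy (u, mat 1)) (\<Theta> (y ** lower_unip C ** z) v) =
      \<Theta> (y ** lower_unip C ** z) v" if "u \<in> unipotent_radical c X" for u
    using radical[OF that] unipotent_fixes_value[OF \<Theta> C(1) _ y z] by blast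
  define c1 where "c1 = (if dy then c else (\<lambda>_. 0))"
  define c2 where "c2 = (if dy then (\<lambda>_. 0) else c)"
  have "\<not> (c1 constant_on UNIV \<and> c2 constant_on UNIV)"
    using X(2) by (auto simp: c1_def c2_def)
  then have "{v. \<forall>m \<in> unipotent_radical c1 X \<times> unipotent_radical c2 X. \<sigma> m v = v} = {0}"
    using cusp X(1) unfolding cuspidal_def by blast
  moreover have "\<forall>m \<in> unipotent_radical c1 X \<times> unipotent_radical c2 X.
      \<sigma> m (\<Theta> (y ** lower_unip C ** z) v) = \<Theta> (y ** lower_unip C ** z) v"
    using fixed unipotent_radical_constant[OF X(1)]
    by (auto simp: c1_def c2_def twist_def split: if_splits)
  ultimately show "\<Theta> (y ** lower_unip C ** z) v = 0"
    by blast
qed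

end

locale length_one_product = parahoric_representation val res \<pi> smul \<sigma>
  for val :: "'f::field \<Rightarrow> int" and res :: "'f \<Rightarrow> 'q::{field,finite}" and \<pi> :: 'f
    and smul :: "'r::field \<Rightarrow> 'v::ab_group_add \<Rightarrow> 'v" and \<sigma> :: "('q, 'k::finite) levi \<Rightarrow> 'v \<Rightarrow> 'v" +
  fixes dy ds dz :: bool and y s z :: "('f, 'k) bmat" and f g :: "'v \<Rightarrow> 'v"
  assumes y: "y \<in> Weyl_type dy 0" and s: "s \<in> Weyl_type ds 0" and z: "z \<in> Weyl_type dz 0"
    and f: "intertwines (dy \<noteq> ds) f" and g: "intertwines (ds \<noteq> dz) g"
begin

abbreviation \<phi> :: "('f, 'k) bmat \<Rightarrow> 'v \<Rightarrow> 'v" where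
  "\<phi> \<equiv> elt (y ** w_mat ** matrix_inv s) f"

abbreviation \<psi> :: "('f, 'k) bmat \<Rightarrow> 'v \<Rightarrow> 'v" where
  "\<psi> \<equiv> elt (s ** w_mat ** z) g"

lemmas y_GL = Weyl_type_GL[OF y] and s_GL = Weyl_type_GL[OF s] and z_GL = Weyl_type_GL[OF z]

lemma elementary_left: "elementary (y ** w_mat ** matrix_inv s) f \<phi>"
  using length_one_type[OF y Weyl_type_inv[OF s, simplified]] f by (rule elementary_hecke_elt)

lemma elementary_right: "elementary (s ** w_mat ** z) g \<psi>"
  using length_one_type[OF s z] g by (rule elementary_hecke_elt)

lemmas biequivariant_factors = elementary_biequivariant[OF elementary_left]
  elementary_biequivariant[OF elementary_right]

lemma finite_cosets_support: "finite_cosets (support \<phi>)"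
  using transversal_finite_cosets[OF transversal_representative[OF y s]]
    elementary_support[OF elementary_left]
  by (rule finite_cosets_subset)

lemma representative_value: "\<phi> (representative y s B) = f"
proof -
  have u: "upper_unip (lift B) \<in> P"
    by (intro upper_unip_parahoric_at mat_ge_lift)
  have "\<phi> (representative y s B) = \<sigma> (reduction res (y ** upper_unip (lift B) ** matrix_inv y)) \<circ> f"
    unfolding representative_eq_conj[OF y_GL] using elementary_self[OF elementary_left]
      biequivariant_left[OF biequivariant_factors(1) elementary_GL[OF elementary_left]
        length_zero_conj[OF y u]]
    by simp
  also have "\<dots> = f"
    unfolding reduction_conj[OF y] by (simp add: reduction_eq)
  finally show ?thesis .
qed

lemma conv_eq_matrix_sum:
  "conv \<phi> \<psi> x v = (\<Sum>B\<in>UNIV. f (\<psi> (s ** w_mat ** upper_unip (- lift B) ** matrix_inv y ** x) v))"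
proof -
  have "dcoset (y ** w_mat ** matrix_inv s) \<subseteq> GL"
    using dcoset_GL elementary_GL[OF elementary_left] by blast
  then have "conv \<phi> \<psi> x v = (\<Sum>h\<in>range (representative y s). \<phi> h (\<psi> (matrix_inv h ** x) v))"
    by (rule conv_eq_sum[OF biequivariant_factors transversal_representative[OF y s]
          elementary_support[OF elementary_left]])
  also have "\<dots> = (\<Sum>B\<in>UNIV. \<phi> (representative y s B) (\<psi> (matrix_inv (representative y s B) ** x) v))"
    using inj_coset_representative[OF y s]
    by (intro sum.reindex[unfolded o_def]) (auto simp: inj_def)
  finally show ?thesis
    by (simp add: representative_value matrix_inv_representative[OF y_GL s_GL])
qed

lemma conv_at_product:
  "conv \<phi> \<psi> (y ** z) v = smul (of_nat (CARD('q) ^ (CARD('k)\<^sup>2))) (f (g v))"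
proof -
  have "\<psi> (s ** w_mat ** upper_unip (- lift B) ** matrix_inv y ** (y ** z)) = g" for B
  proof -
    define u where "u = upper_unip (- lift B)"
    have u: "u \<in> P"
      unfolding u_def by (intro upper_unip_parahoric_at) simp
    have "s ** w_mat ** u ** matrix_inv y ** (y ** z) =
        (s ** w_mat ** z) ** (matrix_inv z ** u ** z)"
      using y_GL z_GL by (simp add: matrix_mul_assoc)
    moreover have "reduction res (matrix_inv z ** u ** z) = (mat 1, mat 1)"
      unfolding reduction_inv_conj[OF z] by (simp add: u_def reduction_eq)
    ultimately show ?thesis
      using biequivariant_right[OF biequivariant_factors(2) elementary_GL[OF elementary_right]
          length_zero_inv_conj[OF z u]] elementary_self[OF elementary_right] by (simp add: u_def)
  qed
  then have "conv \<phi> \<psi> (y ** z) v = (\<Sum>B\<in>(UNIV :: ('q^'k^'k) set). f (g v))"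
    by (simp only: conv_eq_matrix_sum)
  also have "\<dots> = smul (of_nat (CARD('q^'k^'k))) (f (g v))"
    by (rule V.vs1.sum_constant_scale)
  also have "CARD('q^'k^'k) = CARD('q) ^ (CARD('k)\<^sup>2)"
    by (simp add: power2_eq_square flip: power_mult)
  finally show ?thesis .
qed

lemma lower_unip_value:
  assumes C: "mat_ge 0 C"
  shows "\<psi> (s ** lower_unip C ** z) =
    (if reduce C \<in> GL then \<sigma> (twist ds (- matrix_inv (reduce C), reduce C)) \<circ> g else (\<lambda>_. 0))"
proof (cases "reduce C \<in> GL")
  case True
  obtain p q where pq: "p \<in> P" "q \<in> P" "s ** lower_unip C ** z = p ** (s ** w_mat ** z) ** q"
      "reduction res p = twist ds (- matrix_inv (reduce C), reduce C)"
      "reduction res q = (mat 1, mat 1)"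
    using lower_unip_unit_factor[OF C True s z] .
  with True show ?thesis
    unfolding pq(3) elementary_mult[OF elementary_right pq(1,2)] by simp
next
  case False
  then have "s ** lower_unip C ** z \<notin> dcoset (s ** w_mat ** z)"
    using lower_unip_unit_if_factor[OF C s z] unfolding dcoset_def by blast
  with False show ?thesis
    by (simp add: elementary_outside[OF elementary_right])
qed

lemma conv_at_w_product: "conv \<phi> \<psi> (y ** w_mat ** z) v = T_star \<sigma> (f (g v))"
proof -
  have shift: "s ** w_mat ** upper_unip (- lift B) ** matrix_inv y ** (y ** w_mat ** z) =
      s ** lower_unip (- lift B) ** z" for B
    using y_GL by (simp add: matrix_mul_assoc del: block_mult flip: w_mat_conj_upper_unip)
  have f_twist: "f (\<sigma> (twist ds m) u) = \<sigma> (twist (\<not> dy) m) (f u)" if "m \<in> Levi" for m u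
  proof -
    have "((dy \<noteq> ds) = ds) = (\<not> dy)"
      by auto
    with intertwinesD[OF f, of "twist ds m"] that show ?thesis
      by (simp add: twist_twist fun_eq_iff)
  qed
  have "conv \<phi> \<psi> (y ** w_mat ** z) v = (\<Sum>B\<in>UNIV. f (\<psi> (s ** lower_unip (- lift B) ** z) v))"
    by (simp only: conv_eq_matrix_sum shift)
  also have "\<dots> = (\<Sum>B\<in>UNIV. if B \<in> GL then \<sigma> (twist (\<not> dy) (matrix_inv B, - B)) (f (g v)) else 0)"
    using f by (intro sum.cong refl)
      (simp add: lower_unip_value reduce_uminus matrix_inv_uminus f_twist Levi_def intertwines_def
        V.linear_0)
  also have "\<dots> = (\<Sum>B\<in>GL. \<sigma> (twist (\<not> dy) (matrix_inv B, - B)) (f (g v)))"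
    by (simp add: sum.If_cases)
  also have "\<dots> = T_star \<sigma> (f (g v))"
    by (rule T_star_eq_twist_sum[symmetric])
  finally show ?thesis .
qed

lemma product_dcoset_lower_unip:
  assumes "h \<in> dcoset (y ** w_mat ** matrix_inv s)" "k \<in> dcoset (s ** w_mat ** z)"
  obtains C where "mat_ge 0 C" "h ** k \<in> dcoset (y ** lower_unip C ** z)"
proof -
  obtain p q where pq: "p \<in> P" "q \<in> P" "h = p ** (y ** w_mat ** matrix_inv s) ** q"
    using assms(1) by (rule dcosetE)
  obtain p' q' where pq': "p' \<in> P" "q' \<in> P" "k = p' ** (s ** w_mat ** z) ** q'"
    using assms(2) by (rule dcosetE)
  obtain B r where r: "r \<in> P"
      "(matrix_inv s ** (q ** p') ** s) ** w_mat = upper_unip (lift B) ** w_mat ** r"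
    using length_zero_inv_conj[OF s mult_mem[OF pq(2) pq'(1)]]
    by (rule parahoric_at_w_mat_representative)
  have "h ** k = p ** y ** w_mat ** ((matrix_inv s ** (q ** p') ** s) ** w_mat) ** z ** q'"
    by (simp add: pq pq' matrix_mul_assoc)
  also have "\<dots> = p ** y ** (w_mat ** upper_unip (lift B) ** w_mat) ** r ** z ** q'"
    unfolding r(2) by (simp only: matrix_mul_assoc)
  also have "\<dots> = p ** (y ** lower_unip (lift B) ** z) ** (matrix_inv z ** r ** z ** q')"
    unfolding w_mat_conj_upper_unip using z_GL by (simp add: matrix_mul_assoc del: block_mult)
  finally have "h ** k \<in> dcoset (y ** lower_unip (lift B) ** z)"
    using pq(1) mult_mem[OF length_zero_inv_conj[OF z r(1)] pq'(2)] dcosetI by metis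
  then show thesis
    using that[of "lift B"] by simp
qed

lemma support_conv_subset:
  assumes cusp: "cuspidal \<sigma>"
  shows "support (conv \<phi> \<psi>) \<subseteq> dcoset (y ** z) \<union> dcoset (y ** w_mat ** z)"
proof
  fix x
  assume x: "x \<in> support (conv \<phi> \<psi>)"
  note bi = biequivariant_conv[OF biequivariant_factors finite_cosets_support]
  obtain h k where "h \<in> support \<phi>" "k \<in> support \<psi>" "x = h ** k"
    using support_conv[OF biequivariant_factors finite_cosets_support x] .
  then obtain C where C: "mat_ge 0 C" "x \<in> dcoset (y ** lower_unip C ** z)"
    using product_dcoset_lower_unip elementary_support[OF elementary_left]
      elementary_support[OF elementary_right] by blast
  have "y ** lower_unip C ** z \<in> GL"
    using y_GL z_GL by (intro GL_mult GL_lower_unip)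
  then have "y ** lower_unip C ** z \<in> support (conv \<phi> \<psi>)"
    using biequivariant_dcoset_support[OF bi _ C(2) x] by blast
  then consider (zero) "reduce C = 0" | (unit) "reduce C \<in> GL"
    using cuspidal_vanishing[OF cusp bi C(1) _ _ y z] by (auto simp: support_def)
  then have "y ** lower_unip C ** z \<in> dcoset (y ** z) \<union> dcoset (y ** w_mat ** z)"
  proof cases
    case zero
    then have "lower_unip C \<in> P"
      using C(1) by (simp add: lower_unip_parahoric_at_iff reduce_eq_0_iff)
    from dcoset_mult_left[OF dcoset_self length_zero_conj[OF y this], of "y ** z"] show ?thesis
      using y_GL by (simp add: matrix_mul_assoc)
  next
    case unit
    then show ?thesis
      using lower_unip_unit_factor[OF C(1) unit y z] dcosetI by (metis UnI2)
  qed
  with C(2) show "x \<in> dcoset (y ** z) \<union> dcoset (y ** w_mat ** z)"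
    using dcoset_trans by blast
qed

lemma product_notin_w_dcoset: "y ** z \<notin> dcoset (y ** w_mat ** z)"
proof
  assume "y ** z \<in> dcoset (y ** w_mat ** z)"
  then have "y ** lower_unip 0 ** z \<in> dcoset (y ** w_mat ** z)"
    by (simp flip: mat_one_eq_block)
  then obtain p q where pq: "p \<in> P" "q \<in> P" "y ** lower_unip 0 ** z = p ** (y ** w_mat ** z) ** q"
    by (rule dcosetE)
  have "reduce (0 :: 'f^'k^'k) \<in> GL"
    by (rule lower_unip_unit_if_factor[OF mat_ge_zero y z pq])
  then have "(0 :: 'q^'k^'k) ** matrix_inv 0 = mat 1"
    using GL_mult_inv by fastforce
  then show False
    by simp
qed

lemma conv_eq_quadratic:
  assumes cusp: "cuspidal \<sigma>"
  shows "conv \<phi> \<psi> =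
    (\<lambda>x v. smul (of_nat (CARD('q) ^ (CARD('k)\<^sup>2))) (elt (y ** z) (f \<circ> g) x v) +
      elt (y ** w_mat ** z) (T_star \<sigma> \<circ> (f \<circ> g)) x v)"
proof (rule biequivariant_eq_elementary_sum)
  show "biequivariant (conv \<phi> \<psi>)"
    by (rule biequivariant_conv[OF biequivariant_factors finite_cosets_support])
  have parity: "((dy \<noteq> ds) = (ds \<noteq> dz)) = (dy = dz)"
    by auto
  have "elementary (y ** z) (f \<circ> g) (elt (y ** z) (f \<circ> g))"
    using Weyl_type_mult[OF y z] intertwines_compose[OF f g] unfolding parity
    by (rule elementary_hecke_elt)
  from elementary_scale[OF this] show "elementary (y ** z) (conv \<phi> \<psi> (y ** z))
      (\<lambda>x v. smul (of_nat (CARD('q) ^ (CARD('k)\<^sup>2))) (elt (y ** z) (f \<circ> g) x v))"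
    by (simp add: conv_at_product[abs_def] o_def)
  have "intertwines (dy \<noteq> dz) (T_star \<sigma> \<circ> (f \<circ> g))"
    using intertwines_compose[OF intertwines_T_star intertwines_compose[OF f g]] unfolding parity
    by simp
  from elementary_hecke_elt[OF length_one_type[OF y z] this]
  show "elementary (y ** w_mat ** z) (conv \<phi> \<psi> (y ** w_mat ** z))
      (elt (y ** w_mat ** z) (T_star \<sigma> \<circ> (f \<circ> g)))"
    by (simp add: conv_at_w_product[abs_def] o_def)
qed (fact support_conv_subset[OF cusp] product_notin_w_dcoset)+

end

lemma (in parahoric_representation) convolution_quadratic:
  assumes cusp: "cuspidal \<sigma>" and Weyl: "\<eta>' \<in> Weyl \<pi>" "v \<in> simple_refls \<pi>" "\<delta> \<in> Weyl \<pi>"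
    and f: "f \<in> coeff_space smul \<sigma> (\<eta>' ** v)" and g: "g \<in> coeff_space smul \<sigma> \<delta>"
    and len: "len \<pi> \<eta>' = 0" "len \<pi> (\<eta>' ** v ** \<delta>) = 0"
  shows "convolution val (elt (\<eta>' ** v) f) (elt \<delta> g) =
    (\<lambda>x u. smul (of_nat (CARD('q) ^ (CARD('k)\<^sup>2))) (elt (\<eta>' ** v ** \<delta>) (f \<circ> g) x u) +
      elt (\<eta>' ** \<delta>) (T_star \<sigma> \<circ> (f \<circ> g)) x u)"
proof -
  obtain e m d n d' m' where types: "\<eta>' \<in> Weyl_type e m" "v \<in> Weyl_type d n" "\<delta> \<in> Weyl_type d' m'"
    using Weyl Weyl_type_exists simple_refl_type by metis
  have "\<eta>' \<in> Weyl_type e 0"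
    using len(1) types(1) len_Weyl_type[OF types(1)] by simp
  moreover have "\<eta>' ** v ** \<delta> \<in> Weyl_type ((e = d) = d') 0"
    using len(2) Weyl_type_mult[OF Weyl_type_mult[OF types(1,2)] types(3)] len_Weyl_type by force
  ultimately obtain dy ds dz y s z
    where y: "y \<in> Weyl_type dy 0" and s: "s \<in> Weyl_type ds 0" and z: "z \<in> Weyl_type dz 0"
      and eqs: "\<eta>' ** v = y ** w_mat ** matrix_inv s" "\<delta> = s ** w_mat ** z"
        "\<eta>' ** v ** \<delta> = y ** z" "\<eta>' ** \<delta> = y ** w_mat ** z"
    by (rule length_one_factor[OF _ Weyl(2)])
  interpret length_one_product val res \<pi> smul \<sigma> dy ds dz y s z f g
  proof
    show "intertwines (dy \<noteq> ds) f"
      using length_one_type[OF y Weyl_type_inv[OF s, simplified]] f unfolding eqs(1)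
      by (rule coeff_space_intertwines)
    show "intertwines (ds \<noteq> dz) g"
      using length_one_type[OF s z] g unfolding eqs(2) by (rule coeff_space_intertwines)
  qed (fact y s z)+
  show ?thesis
    unfolding eqs(3,4) unfolding eqs(1,2) convolution_eq by (rule conv_eq_quadratic[OF cusp])
qed

lemma of_nat_mod_CHAR: "(of_nat (n mod CHAR('a)) :: 'a::semiring_1) = of_nat n"
proof -
  have "(of_nat n :: 'a) = of_nat (CHAR('a) * (n div CHAR('a)) + n mod CHAR('a))"
    by simp
  also have "\<dots> = of_nat (n mod CHAR('a))"
    unfolding of_nat_add of_nat_mult by simp
  finally show ?thesis ..
qed

theorem theorem3p6:
  fixes val :: "'f::field \<Rightarrow> int"
    and res :: "'f \<Rightarrow> 'q::{field,finite}"
    and \<pi> :: 'f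
    and smul :: "'r::alg_closed_field \<Rightarrow> 'v::ab_group_add \<Rightarrow> 'v"
    and \<sigma> :: "('q, 'k::finite) levi \<Rightarrow> 'v \<Rightarrow> 'v"
    and \<eta> \<delta> :: "('f, 'k) bmat"
    and f g :: "'v \<Rightarrow> 'v"
  assumes "nonarch_local_field val res"
    and "uniformizer val \<pi>"
    and "CHAR('r) \<noteq> CHAR('q)"
    and "\<exists>Basis. finite_dimensional_vector_space smul Basis"
    and "representation smul \<sigma>"
    and "cuspidal \<sigma>"
    and "\<eta> \<in> Weyl \<pi>" and "\<delta> \<in> Weyl \<pi>"
    and "f \<in> coeff_space smul \<sigma> \<eta>" and "g \<in> coeff_space smul \<sigma> \<delta>"
  shows
    "(len \<pi> (\<eta> ** \<delta>) = len \<pi> \<eta> + len \<pi> \<delta> \<longrightarrow>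
        convolution val (hecke_elt smul val res \<sigma> \<eta> f) (hecke_elt smul val res \<sigma> \<delta> g)
          = hecke_elt smul val res \<sigma> (\<eta> ** \<delta>) (f \<circ> g))
     \<and>
     (\<forall>\<eta>' v. \<eta>' \<in> Weyl \<pi> \<and> v \<in> simple_refls \<pi> \<and> \<eta> = \<eta>' ** v \<and> len \<pi> \<eta> = len \<pi> \<eta>' + 1 \<longrightarrow>
        len \<pi> \<eta> = 1 \<and> len \<pi> \<delta> = 1 \<and> len \<pi> (\<eta> ** \<delta>) = 0 \<longrightarrow>
        convolution val (hecke_elt smul val res \<sigma> \<eta> f) (hecke_elt smul val res \<sigma> \<delta> g)
          = (\<lambda>x u. smul (of_nat (CARD('q) ^ (CARD('k)\<^sup>2) mod CHAR('r)))
                         (hecke_elt smul val res \<sigma> (\<eta> ** \<delta>) (f \<circ> g) x u)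
                   + hecke_elt_T smul val res \<sigma> 1 (\<eta>' ** \<delta>) (f \<circ> g) x u))"
proof -
  have "vector_space smul"
    using assms(4) finite_dimensional_vector_space.axioms(1) by blast
  with assms(1,2,5) interpret parahoric_representation val res \<pi> smul \<sigma>
    by (intro parahoric_representation.intro parahoric_representation_axioms.intro
        local_field_uniformizer.intro local_field_uniformizer_axioms.intro)
  show ?thesis
    using convolution_additive[OF assms(7-10)] assms(9)
      convolution_quadratic[OF assms(6) _ _ assms(8) _ assms(10)]
    by (auto simp: of_nat_mod_CHAR hecke_elt_T_def)
qed

end
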